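(* Let $p$ and $q$ be relatively prime integers with $2<p<q$. For each integer $n\ge p+q-2$, $$H(n,p,q)=\begin{cases} H^s(n,p,q) & \text{if } n\le q+p\lceil q/p\rceil-1 \text{ or } 3q\le n\le q+3p-1,\\ H^d(n,p,q) & \text{otherwise.}\end{cases}$$ Moreover, for each integer $h\ge 0$, $$L(h,p,q)=\begin{cases} L^s(h,p,q) & \text{if } \tfrac{q}{p}>\lceil h/2\rceil \text{ or } \big(h=4 \text{ and } \tfrac{q}{p}<\tfrac32\big),\\ L^d(h,p,q) & \text{otherwise.}\end{cases}$$
   Context: A partial word of length $n$ is a sequence $X=X[0]X[1]\cdots X[n-1]$ over $\Sigma\cup\{\diamondsuit\}$, where $\Sigma$ is an alphabet and $\diamondsuit\notin\Sigma$ is a hole; positions holding $\diamondsuit$ are holes. For $a,b\in\Sigma\cup\{\diamondsuit\}$ write $a\approx b$ if $a=b$ or one of them is $\diamondsuit$. A positive integer $r$ is a (strong) period of $X$ if there is a word $P\in\Sigma^r$ with $X[i]\approx P[i\bmod r]$ for all $0\le i<n$. $H(n,p,q)$ is the minimum number of holes in a partial word of length $n$ that has periods $p$ and $q$ but does not have period $\gcd(p,q)$ ($+\infty$ if there is none). $L(h,p,q)$ is the least $n_0$ such that every partial word with at most $h$ holes, periods $p,q$ and length at least $n_0$ has period $\gcd(p,q)$; equivalently the least $n_0$ with $H(n,p,q)>h$ for all $n\ge n_0$. $H^s(n,p,q)=\lfloor (n-q)/p\rfloor+\lfloor (n-q+1)/p\rfloor$ and $L^s(h,p,q)=\min\{n\ge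 q: H^s(n,p,q)>h\}$. For $n\ge 1$, a partial word $S$ of length $n$ is $(p,q)$-special if there is a position $l$ such that for every position $i$: $S[i]=\mathsf a$ if $p\nmid (l-i)$ and $q\nmid(l-i)$; $S[i]=\mathsf b$ if $p\mid(l-i)$ and $q\mid(l-i)$; and $S[i]=\diamondsuit$ otherwise (where $\mathsf a\neq\mathsf b$ are letters). $H^d(n,p,q)$ is the minimum number of holes in a $(p,q)$-special partial word of length $n$, and $L^d(h,p,q)=\min\{n\ge1: H^d(n,p,q)>h\}$. *)

theory Defs
  imports Complex_Main "HOL-Library.Extended_Nat"
begin

(* A hole is None, a letter c is Some c.  The alphabet is an arbitrary set \<Sigma> of letters. *)
type_synonym 'a pword = "'a option list"

definition pwords :: "'a set \<Rightarrow> nat \<Rightarrow> 'a pword set" where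
  "pwords \<Sigma> n = {X. length X = n \<and> set X \<subseteq> insert None (Some ` \<Sigma>)}"

definition holes :: "'a pword \<Rightarrow> nat" where
  "holes X = card {i. i < length X \<and> X ! i = None}"

definition compat :: "'a option \<Rightarrow> 'a option \<Rightarrow> bool" where
  "compat a b \<longleftrightarrow> a = b \<or> a = None \<or> b = None"

definition has_period :: "'a set \<Rightarrow> 'a pword \<Rightarrow> nat \<Rightarrow> bool" where
  "has_period \<Sigma> X r \<longleftrightarrow> 0 < r \<and>
     (\<exists>P. length P = r \<and> set P \<subseteq> \<Sigma> \<and> (\<forall>i<length X. compat (X ! i) (Some (P ! (i mod r)))))"

(* All minima below are infima in enat: an attained minimum whenever the set is nonempty,
   and \<infinity> when it is empty. *)

definition H :: "'a set \<Rightarrow> nat \<Rightarrow> nat \<Rightarrow> nat \<Rightarrow> enat" where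
  "H \<Sigma> n p q = Inf {enat (holes X) | X. X \<in> pwords \<Sigma> n \<and>
     has_period \<Sigma> X p \<and> has_period \<Sigma> X q \<and> \<not> has_period \<Sigma> X (gcd p q)}"

definition L :: "'a set \<Rightarrow> nat \<Rightarrow> nat \<Rightarrow> nat \<Rightarrow> enat" where
  "L \<Sigma> h p q = Inf {enat n0 | n0. \<forall>n\<ge>n0. \<forall>X\<in>pwords \<Sigma> n.
     holes X \<le> h \<and> has_period \<Sigma> X p \<and> has_period \<Sigma> X q \<longrightarrow> has_period \<Sigma> X (gcd p q)}"

definition Hs :: "nat \<Rightarrow> nat \<Rightarrow> nat \<Rightarrow> int" where
  "Hs n p q = \<lfloor>(real n - real q) / real p\<rfloor> + \<lfloor>(real n - real q + 1) / real p\<rfloor>"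

definition Ls :: "nat \<Rightarrow> nat \<Rightarrow> nat \<Rightarrow> enat" where
  "Ls h p q = Inf {enat n | n. n \<ge> q \<and> Hs n p q > int h}"

definition special :: "'a set \<Rightarrow> nat \<Rightarrow> nat \<Rightarrow> 'a pword \<Rightarrow> bool" where
  "special \<Sigma> p q S \<longleftrightarrow> (\<exists>a\<in>\<Sigma>. \<exists>b\<in>\<Sigma>. a \<noteq> b \<and>
     (\<exists>l<length S. \<forall>i<length S.
        S ! i = (if \<not> int p dvd int l - int i \<and> \<not> int q dvd int l - int i then Some a
                 else if int p dvd int l - int i \<and> int q dvd int l - int i then Some b
                 else None)))"

definition Hd :: "'a set \<Rightarrow> nat \<Rightarrow> nat \<Rightarrow> nat \<Rightarrow> enat" where
  "Hd \<Sigma> n p q = Inf {enat (holes S) | S. S \<in> pwords \<Sigma> n \<and> special \<Sigma> p q S}"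

definition Ld :: "'a set \<Rightarrow> nat \<Rightarrow> nat \<Rightarrow> nat \<Rightarrow> enat" where
  "Ld \<Sigma> h p q = Inf {enat n | n. n \<ge> 1 \<and> Hd \<Sigma> n p q > enat h}"

end

theory Submission
  imports Defs "HOL-Number_Theory.Cong"
begin

text \<open>
  Merging letters, a word with periods \<open>p\<close> and \<open>q\<close> but not \<open>1\<close> becomes a pair of two-colorings \<open>f\<close>
  of the residues modulo \<open>p\<close> and \<open>g\<close> of the residues modulo \<open>q\<close>; its holes are at least the positions
  where \<open>f\<close> and \<open>g\<close> differ, and each color must occur at a position where they agree. Order the residues
  modulo \<open>p\<close> cyclically by steps of \<open>q\<close> and call \<open>t\<close> a boundary if \<open>f\<close> differs at \<open>t\<close> and \<open>t + q\<close>.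
  If \<open>f\<close> singles out one residue, the word has, once \<open>n \<ge> 2q\<close>, at least as many holes as some special
  word. Otherwise there are two boundaries that are not consecutive on the cycle, so the pairs
  \<open>(t, t + q)\<close> starting at positions congruent to one of them are disjoint and each contains a hole;
  their number is at least \<open>Hs\<close>. Hence \<open>H\<close> is at least the minimum of \<open>Hs\<close> and \<open>Hd\<close>, and the formula
  for \<open>H\<close> reduces to comparing these two. The comparison fails only for some \<open>n \<ge> 4q\<close> with
  \<open>q\<close> close to \<open>p\<close>, where one additional disjoint pair \<open>(j, j + 3q)\<close> makes up the difference.
\<close>

section \<open>Two-colorings\<close>

definition periodic :: "(nat \<Rightarrow> bool) \<Rightarrow> nat \<Rightarrow> bool" where
  "periodic f r \<longleftrightarrow> (\<forall>i. f (i + r) = f i)"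

definition mismatches :: "nat \<Rightarrow> (nat \<Rightarrow> bool) \<Rightarrow> (nat \<Rightarrow> bool) \<Rightarrow> nat set" where
  "mismatches n f g = {i. i < n \<and> f i \<noteq> g i}"

text \<open>Encodes the word that shows the common color where \<open>f\<close> and \<open>g\<close>
  agree and a hole where they differ. The last two conditions make both letters occur, which
  excludes the period \<open>gcd p q = 1\<close>.\<close>

definition coloring :: "nat \<Rightarrow> nat \<Rightarrow> nat \<Rightarrow> (nat \<Rightarrow> bool) \<Rightarrow> (nat \<Rightarrow> bool) \<Rightarrow> bool" where
  "coloring n p q f g \<longleftrightarrow> periodic f p \<and> periodic g q \<and>
     (\<exists>i<n. f i \<and> g i) \<and> (\<exists>i<n. \<not> f i \<and> \<not> g i)"

text \<open>These are the holes of the special word centered at \<open>l\<close>: the two class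
  indicators differ exactly when one of the two divisibilities holds.\<close>

definition special_mismatches :: "nat \<Rightarrow> nat \<Rightarrow> nat \<Rightarrow> nat \<Rightarrow> nat set" where
  "special_mismatches p q n l = mismatches n (\<lambda>i. [i = l] (mod p)) (\<lambda>i. [i = l] (mod q))"

lemma coloringI:
  assumes "periodic f p" "periodic g q" "i < n" "j < n" "f i \<noteq> f j" "g i = f i" "g j = f j"
  shows "coloring n p q f g"
  using assms unfolding coloring_def by (cases "f i") auto

lemma finite_mismatches [simp]: "finite (mismatches n f g)"
  by (simp add: mismatches_def)

lemma periodic_mult: "periodic f r \<Longrightarrow> f (i + k * r) = f i"
proof (induction k)
  case (Suc k)
  then show ?case unfolding periodic_def by (metis add.assoc add.commute mult_Suc)
qed simp

lemma periodic_mod: "periodic f r \<Longrightarrow> f (i mod r) = f i"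
  using periodic_mult[of f r "i mod r" "i div r"] by simp

lemma periodic_cong: "periodic f r \<Longrightarrow> [i = j] (mod r) \<Longrightarrow> f i = f j"
  by (metis cong_def periodic_mod)

lemma periodic_cong_const: "periodic (\<lambda>i. [i = l] (mod r)) r"
  by (simp add: periodic_def cong_def)

section \<open>Translation between partial words and two-colorings\<close>

lemma has_period_one_iff:
  "has_period \<Sigma> X 1 \<longleftrightarrow> (\<exists>c\<in>\<Sigma>. \<forall>i<length X. X ! i \<in> {None, Some c})"
proof
  assume "has_period \<Sigma> X 1"
  then obtain P where P: "length P = 1" "set P \<subseteq> \<Sigma>"
    "\<forall>i<length X. compat (X ! i) (Some (P ! (i mod 1)))"
    unfolding has_period_def by blast
  then obtain c where "P = [c]" by (metis One_nat_def length_0_conv length_Suc_conv)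
  with P show "\<exists>c\<in>\<Sigma>. \<forall>i<length X. X ! i \<in> {None, Some c}"
    by (auto simp: compat_def)
next
  assume "\<exists>c\<in>\<Sigma>. \<forall>i<length X. X ! i \<in> {None, Some c}"
  then obtain c where c: "c \<in> \<Sigma>" "\<forall>i<length X. X ! i \<in> {None, Some c}" by blast
  then show "has_period \<Sigma> X 1"
    unfolding has_period_def by (intro conjI exI[of _ "[c]"]) (auto simp: compat_def)
qed

lemma H_le_card_mismatches:
  assumes "a \<in> \<Sigma>" "b \<in> \<Sigma>" "a \<noteq> b" "coprime p q" "0 < p" "0 < q" "coloring n p q f g"
  shows "H \<Sigma> n p q \<le> enat (card (mismatches n f g))"
proof -
  define w where "w = (\<lambda>x. if x then a else b)"
  define X where "X = map (\<lambda>i. if f i \<noteq> g i then None else Some (w (f i))) [0..<n]"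
  have len: "length X = n" by (simp add: X_def)
  have nth: "X ! i = (if f i \<noteq> g i then None else Some (w (f i)))" if "i < n" for i
    using that by (simp add: X_def)
  have w: "w x \<in> \<Sigma>" for x using assms by (simp add: w_def)
  have per: "periodic f p" "periodic g q" using assms by (auto simp: coloring_def)
  have "X \<in> pwords \<Sigma> n" using w by (auto simp: pwords_def X_def)
  moreover have "has_period \<Sigma> X p" unfolding has_period_def
  proof (intro conjI exI[of _ "map (w \<circ> f) [0..<p]"])
    show "\<forall>i<length X. compat (X ! i) (Some (map (w \<circ> f) [0..<p] ! (i mod p)))"
      using nth len assms(5) periodic_mod[OF per(1)] by (auto simp: compat_def)
  qed (use w assms(5) in auto)
  moreover have "has_period \<Sigma> X q" unfolding has_period_def
  proof (intro conjI exI[of _ "map (w \<circ> g) [0..<q]"])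
    show "\<forall>i<length X. compat (X ! i) (Some (map (w \<circ> g) [0..<q] ! (i mod q)))"
      using nth len assms(6) periodic_mod[OF per(2)] by (auto simp: compat_def)
  qed (use w assms(6) in auto)
  moreover have "\<not> has_period \<Sigma> X (gcd p q)"
  proof
    assume "has_period \<Sigma> X (gcd p q)"
    then have "has_period \<Sigma> X 1" using assms(4) by simp
    then obtain c where c: "\<forall>i<length X. X ! i \<in> {None, Some c}"
      unfolding has_period_one_iff by blast
    obtain i j where ij: "i < n" "f i" "g i" "j < n" "\<not> f j" "\<not> g j"
      using assms(7) by (auto simp: coloring_def)
    then have "X ! i = Some a" "X ! j = Some b" using nth by (auto simp: w_def)
    moreover have "X ! i \<in> {None, Some c}" "X ! j \<in> {None, Some c}" using c ij len by auto
    ultimately show False using assms(3) by simp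
  qed
  moreover have "holes X = card (mismatches n f g)"
    unfolding holes_def mismatches_def len using nth by (intro arg_cong[of _ _ card]) (auto split: if_splits)
  ultimately show ?thesis unfolding H_def by (intro Inf_lower) (auto intro!: exI[of _ X])
qed

text \<open>Merging all letters other than one letter \<open>c\<close> of \<open>X\<close> turns the
  period words into colorings. These agree wherever \<open>X\<close> has a letter, so every mismatch
  is a hole; holes at which they happen to agree leave only an inequality.\<close>

lemma coloring_of_word:
  assumes "\<Sigma> \<noteq> {}" "coprime p q" "X \<in> pwords \<Sigma> n" "has_period \<Sigma> X p" "has_period \<Sigma> X q"
    "\<not> has_period \<Sigma> X (gcd p q)"
  obtains f g where "coloring n p q f g" "card (mismatches n f g) \<le> holes X"
proof -
  have len: "length X = n" using assms(3) by (simp add: pwords_def)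
  have el: "X ! i = None \<or> (\<exists>c\<in>\<Sigma>. X ! i = Some c)" if "i < n" for i
    using assms(3) that nth_mem[of i X] unfolding pwords_def by fastforce
  have no: "\<not> (\<exists>c\<in>\<Sigma>. \<forall>i<n. X ! i \<in> {None, Some c})"
    using assms(2,6) has_period_one_iff[of \<Sigma> X] len by simp
  \<comment> \<open>A word consisting of holes only would have period 1 because
    \<open>\<Sigma>\<close> is nonempty, so some letter occurs.\<close>
  then obtain i c where ic: "i < n" "X ! i = Some c" "c \<in> \<Sigma>" using assms(1) el by (metis ex_in_conv insert_iff)
  then obtain j c' where jc: "j < n" "X ! j = Some c'" "c' \<noteq> c" using no el by (metis insert_iff)
  obtain P where P: "\<forall>i<n. compat (X ! i) (Some (P ! (i mod p)))"
    using assms(4) len unfolding has_period_def by blast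
  obtain Q where Q: "\<forall>i<n. compat (X ! i) (Some (Q ! (i mod q)))"
    using assms(5) len unfolding has_period_def by blast
  define f where "f = (\<lambda>i. P ! (i mod p) = c)"
  define g where "g = (\<lambda>i. Q ! (i mod q) = c)"
  have agree: "P ! (i mod p) = d \<and> Q ! (i mod q) = d" if "i < n" "X ! i = Some d" for i d
    using P Q that by (auto simp: compat_def)
  have "periodic f p" "periodic g q" by (auto simp: periodic_def f_def g_def)
  then have "coloring n p q f g"
    using agree[OF ic(1,2)] agree[OF jc(1,2)] ic jc unfolding coloring_def f_def g_def by auto
  moreover have "mismatches n f g \<subseteq> {i. i < length X \<and> X ! i = None}"
  proof
    fix i assume "i \<in> mismatches n f g"
    then have i: "i < n" "f i \<noteq> g i" by (auto simp: mismatches_def)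
    then have "X ! i = None" using agree[of i] by (cases "X ! i") (auto simp: f_def g_def)
    then show "i \<in> {i. i < length X \<and> X ! i = None}" using i len by simp
  qed
  then have "card (mismatches n f g) \<le> holes X"
    unfolding holes_def by (intro card_mono) auto
  ultimately show ?thesis using that by blast
qed

lemma le_H:
  assumes "\<Sigma> \<noteq> {}" "coprime p q"
    and "\<And>f g. coloring n p q f g \<Longrightarrow> k \<le> enat (card (mismatches n f g))"
  shows "k \<le> H \<Sigma> n p q"
  unfolding H_def
proof (rule Inf_greatest)
  fix x assume "x \<in> {enat (holes X) | X. X \<in> pwords \<Sigma> n \<and>
     has_period \<Sigma> X p \<and> has_period \<Sigma> X q \<and> \<not> has_period \<Sigma> X (gcd p q)}"
  then obtain X where X: "x = enat (holes X)" "X \<in> pwords \<Sigma> n" "has_period \<Sigma> X p"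
    "has_period \<Sigma> X q" "\<not> has_period \<Sigma> X (gcd p q)" by blast
  obtain f g where "coloring n p q f g" "card (mismatches n f g) \<le> holes X"
    using coloring_of_word[OF assms(1,2) X(2-5)] .
  then show "k \<le> x" using assms(3) X(1) by (meson enat_ord_simps(1) order_trans)
qed

section \<open>Special words\<close>

lemma cong_iff_int_dvd: "[i = l] (mod p) \<longleftrightarrow> int p dvd int l - int i"
  by (metis cong_iff_dvd_diff cong_int_iff cong_sym_eq)

lemma Hd_le_card:
  assumes "a \<in> \<Sigma>" "b \<in> \<Sigma>" "a \<noteq> b" "l < n"
  shows "Hd \<Sigma> n p q \<le> enat (card (special_mismatches p q n l))"
proof -
  define S where "S = map (\<lambda>i. if \<not> [i = l] (mod p) \<and> \<not> [i = l] (mod q) then Some a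
                 else if [i = l] (mod p) \<and> [i = l] (mod q) then Some b else None) [0..<n]"
  have "S \<in> pwords \<Sigma> n" using assms by (auto simp: pwords_def S_def)
  moreover have "special \<Sigma> p q S"
    unfolding special_def cong_iff_int_dvd[symmetric]
    using assms by (intro bexI[of _ a] bexI[of _ b] conjI exI[of _ l]) (auto simp: S_def)
  moreover have "holes S = card (special_mismatches p q n l)"
    unfolding holes_def special_mismatches_def mismatches_def
    by (intro arg_cong[of _ _ card]) (auto simp: S_def split: if_splits)
  ultimately show ?thesis unfolding Hd_def by (intro Inf_lower) (auto intro!: exI[of _ S])
qed

lemma le_Hd:
  assumes "\<And>l. l < n \<Longrightarrow> k \<le> enat (card (special_mismatches p q n l))"
  shows "k \<le> Hd \<Sigma> n p q"
  unfolding Hd_def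
proof (rule Inf_greatest)
  fix x assume "x \<in> {enat (holes S) | S. S \<in> pwords \<Sigma> n \<and> special \<Sigma> p q S}"
  then obtain S where S: "x = enat (holes S)" "S \<in> pwords \<Sigma> n" "special \<Sigma> p q S" by blast
  have len: "length S = n" using S(2) by (simp add: pwords_def)
  obtain a b l where abl: "a \<noteq> b" "l < n" "\<forall>i<n. S ! i = (if \<not> [i = l] (mod p) \<and> \<not> [i = l] (mod q) then Some a
                 else if [i = l] (mod p) \<and> [i = l] (mod q) then Some b else None)"
    using S(3) unfolding special_def cong_iff_int_dvd[symmetric] len by blast
  have "holes S = card (special_mismatches p q n l)"
    unfolding holes_def special_mismatches_def mismatches_def len
    by (intro arg_cong[of _ _ card]) (use abl(3) in \<open>auto split: if_splits\<close>)
  then show "k \<le> x" using assms[OF abl(2)] S(1) by simp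
qed

lemma Hd_mono:
  assumes "a \<in> \<Sigma>" "b \<in> \<Sigma>" "a \<noteq> b" "1 \<le> n" "n \<le> n'"
  shows "Hd \<Sigma> n p q \<le> Hd \<Sigma> n' p q"
proof (rule le_Hd)
  fix l' assume l': "l' < n'"
  \<comment> \<open>Cut out a factor of length \<open>n\<close> that contains the position \<open>l'\<close>.\<close>
  define s where "s = (if l' < n then 0 else l' - n + 1)"
  define l where "l = l' - s"
  have l: "l < n" "l' = l + s" "s + n \<le> n'" using l' assms by (auto simp: l_def s_def)
  have "(\<lambda>i. i + s) ` special_mismatches p q n l \<subseteq> special_mismatches p q n' l'"
    using l by (auto simp: special_mismatches_def mismatches_def cong_add_rcancel_nat)
  then have "card (special_mismatches p q n l) \<le> card (special_mismatches p q n' l')"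
    using card_mono[OF finite_mismatches, of "(\<lambda>i. i + s) ` special_mismatches p q n l"]
    unfolding special_mismatches_def by (simp add: card_image)
  then show "Hd \<Sigma> n p q \<le> enat (card (special_mismatches p q n' l'))"
    using Hd_le_card[OF assms(1-3) l(1), of p q] by (meson enat_ord_simps(1) order_trans)
qed

section \<open>Counting positions in residue classes\<close>

text \<open>The count is the ceiling of \<open>(m - u) / r\<close>; adding \<open>r\<close> first
  keeps the subtraction from truncating.\<close>

lemma card_cong_below:
  fixes u r m :: nat
  assumes "u < r"
  shows "card {t. t < m \<and> [t = u] (mod r)} = (m + r - 1 - u) div r"
proof -
  have "{t. t < m \<and> [t = u] (mod r)} = (\<lambda>k. u + k * r) ` {..<(m + r - 1 - u) div r}" (is "?A = ?B")
  proof
    show "?A \<subseteq> ?B"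
    proof
      fix t assume "t \<in> ?A"
      then have t: "t < m" "t mod r = u" using assms by (auto simp: cong_def)
      then have "t = u + (t div r) * r" by (metis add.commute div_mult_mod_eq)
      moreover have "Suc (t div r) * r \<le> m + r - 1 - u"
        using t calculation assms by simp
      then have "t div r < (m + r - 1 - u) div r"
        using assms by (metis Suc_le_eq less_eq_div_iff_mult_less_eq less_zeroE neq0_conv)
      ultimately show "t \<in> ?B" by blast
    qed
    show "?B \<subseteq> ?A"
    proof
      fix t assume "t \<in> ?B"
      then obtain k where k: "t = u + k * r" "Suc k \<le> (m + r - 1 - u) div r"
        by (auto simp: Suc_le_eq)
      then have "Suc k * r \<le> m + r - 1 - u"
        using assms by (metis less_eq_div_iff_mult_less_eq less_zeroE neq0_conv)
      then show "t \<in> ?A" using k assms by (auto simp: cong_def)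
    qed
  qed
  moreover have "inj_on (\<lambda>k. u + k * r) {..<(m + r - 1 - u) div r}"
    using assms by (auto simp: inj_on_def)
  ultimately show ?thesis by (simp add: card_image)
qed

lemma split_at_residue:
  fixes l r n :: nat
  assumes "l < n" "0 < r"
  shows "n + r - 1 - l mod r = (n - 1 - l) + (l div r + 1) * r"
proof -
  have "l = l mod r + l div r * r" by simp
  moreover have "l mod r < r" using assms by simp
  moreover have "(l div r + 1) * r = l div r * r + r" by simp
  ultimately show ?thesis using assms(1) by linarith
qed

lemma card_cong_class:
  fixes l r n :: nat
  assumes "l < n" "0 < r"
  shows "card {i. i < n \<and> [i = l] (mod r)} = l div r + (n - 1 - l) div r + 1"
proof -
  have "{i. i < n \<and> [i = l] (mod r)} = {i. i < n \<and> [i = l mod r] (mod r)}" by simp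
  then have "card {i. i < n \<and> [i = l] (mod r)} = (n + r - 1 - l mod r) div r"
    using card_cong_below[of "l mod r" r n] assms by simp
  also have "n + r - 1 - l mod r = (n - 1 - l) + (l div r + 1) * r"
    using assms by (rule split_at_residue)
  also have "\<dots> div r = l div r + (n - 1 - l) div r + 1"
    using assms div_mult_self1[of r "n - 1 - l" "l div r + 1"] by (simp only:)
  finally show ?thesis .
qed

lemma card_two_residues:
  fixes u v r m :: nat
  assumes "u < r" "v < r" "u \<noteq> v"
  shows "card {t. t < m \<and> ([t = u] (mod r) \<or> [t = v] (mod r))} =
    (m + r - 1 - u) div r + (m + r - 1 - v) div r"
proof -
  have "{t. t < m \<and> ([t = u] (mod r) \<or> [t = v] (mod r))} =
     {t. t < m \<and> [t = u] (mod r)} \<union> {t. t < m \<and> [t = v] (mod r)}" by auto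
  moreover have "{t. t < m \<and> [t = u] (mod r)} \<inter> {t. t < m \<and> [t = v] (mod r)} = {}"
    using assms by (auto simp: cong_def)
  ultimately show ?thesis using assms card_cong_below[of u r m] card_cong_below[of v r m]
    by (simp add: card_Un_disjoint)
qed

text \<open>Larger residues have no more members below \<open>m\<close>, so the residues
  \<open>r - 1\<close> and \<open>r - 2\<close> are the worst case. For \<open>r = p\<close> and
  \<open>m = n - q\<close> this minimum is the value of \<open>Hs\<close>.\<close>

lemma card_two_residues_ge:
  fixes u v r m :: nat
  assumes "u < r" "v < r" "u \<noteq> v"
  shows "m div r + (m + 1) div r \<le> card {t. t < m \<and> ([t = u] (mod r) \<or> [t = v] (mod r))}"
  using assms
proof (induction u v rule: linorder_wlog)
  case (le u v)
  then have "m div r \<le> (m + r - 1 - v) div r" "(m + 1) div r \<le> (m + r - 1 - u) div r"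
    by (auto intro!: div_le_mono)
  then show ?case using card_two_residues[OF le(2-4), of m] by linarith
next
  case (sym u v)
  then show ?case by (simp add: disj_commute)
qed

lemma card_last_two_residues:
  fixes r m :: nat
  assumes "2 \<le> r"
  shows "card {t. t < m \<and> ([t = r - 1] (mod r) \<or> [t = r - 2] (mod r))} = m div r + (m + 1) div r"
  using card_two_residues[of "r - 1" r "r - 2" m] assms by (simp add: Suc_diff_le)

lemma card_special_le:
  assumes "l < n" "0 < p" "0 < q"
  shows "card (special_mismatches p q n l) \<le>
    l div p + (n - 1 - l) div p + (l div q + (n - 1 - l) div q)"
proof -
  let ?A = "\<lambda>r. {i. i < n \<and> [i = l] (mod r)}"
  have c: "card (?A r - {l}) = l div r + (n - 1 - l) div r" if "0 < r" for r
    using card_cong_class[OF assms(1) that] assms(1) by simp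
  have "special_mismatches p q n l \<subseteq> (?A p - {l}) \<union> (?A q - {l})"
    by (auto simp: special_mismatches_def mismatches_def)
  then have "card (special_mismatches p q n l) \<le> card ((?A p - {l}) \<union> (?A q - {l}))"
    by (intro card_mono) auto
  also have "\<dots> \<le> card (?A p - {l}) + card (?A q - {l})" by (rule card_Un_le)
  finally show ?thesis using c assms by simp
qed

text \<open>Coprimality and \<open>n \<le> p * q\<close> leave \<open>l\<close> as the only position
  congruent to \<open>l\<close> modulo both periods, so the two classes without \<open>l\<close> are
  disjoint. Each class has at least \<open>n div r\<close> members, and removing \<open>l\<close>
  from both costs the 2.\<close>

lemma card_special_ge:
  assumes "l < n" "0 < p" "0 < q" "coprime p q" "n \<le> p * q"
  shows "n div p + n div q \<le> card (special_mismatches p q n l) + 2"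
proof -
  let ?A = "\<lambda>r. {i. i < n \<and> [i = l] (mod r)}"
  have c: "n div r \<le> card (?A r - {l}) + 1" if "0 < r" for r
  proof -
    have "card (?A r - {l}) + 1 = l div r + (n - 1 - l) div r + 1"
      using card_cong_class[OF assms(1) that] assms(1) by simp
    moreover have "n div r \<le> l div r + (n - 1 - l) div r + 1"
    proof -
      have "n + r - 1 - l mod r = (n - 1 - l) + (l div r + 1) * r"
        using assms(1) that by (rule split_at_residue)
      then have "n \<le> (n - 1 - l) + (l div r + 1) * r"
        using mod_less_divisor[OF that, of l] by linarith
      then have "n div r \<le> ((n - 1 - l) + (l div r + 1) * r) div r" by (rule div_le_mono)
      then show ?thesis using that div_mult_self1[of r "n - 1 - l" "l div r + 1"] by linarith
    qed
    ultimately show ?thesis by simp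
  qed
  have eq: "i = l" if "i < n" "[i = l] (mod p)" "[i = l] (mod q)" for i
  proof -
    have "[i = l] (mod p * q)" using that assms(4) by (simp add: coprime_cong_mult_nat)
    then show ?thesis using that(1) assms(1,5) by (simp add: cong_less_modulus_unique_nat)
  qed
  have "special_mismatches p q n l = (?A p - {l}) \<union> (?A q - {l})"
    using eq by (auto simp: special_mismatches_def mismatches_def)
  moreover have "(?A p - {l}) \<inter> (?A q - {l}) = {}" using eq by auto
  ultimately have "card (special_mismatches p q n l) = card (?A p - {l}) + card (?A q - {l})"
    by (simp add: card_Un_disjoint)
  then show ?thesis using c[OF assms(2)] c[OF assms(3)] by linarith
qed

section \<open>Lower bounds\<close>

lemma mod_eq_diff_mult: "k * r \<le> i \<Longrightarrow> i < (k + 1) * r \<Longrightarrow> i mod r = i - k * r" for i k r :: nat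
proof -
  assume "k * r \<le> i" "i < (k + 1) * r"
  then have "i = (i - k * r) + k * r" "i - k * r < r" by auto
  then show ?thesis by (metis mod_less mod_mult_self1)
qed

section \<open>The cycle of residues modulo \<open>p\<close> and its boundaries\<close>

locale coprime_periods =
  fixes p q :: nat
  assumes coprime_pq: "coprime p q" and p_gt_2: "2 < p" and p_less_q: "p < q"
begin

text \<open>The natural-number form of \<open>Hs\<close>, equal to it for
  \<open>q \<le> n\<close>.\<close>

abbreviation hs :: "nat \<Rightarrow> nat" where
  "hs n \<equiv> (n - q) div p + (n - q + 1) div p"

abbreviation sm :: "nat \<Rightarrow> nat \<Rightarrow> nat" where
  "sm n l \<equiv> card (special_mismatches p q n l)"

lemma q_steps_cong_iff: "[b + k * q = b + l * q] (mod p) \<longleftrightarrow> [k = l] (mod p)"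
  using coprime_pq by (simp add: cong_add_lcancel_nat cong_mult_rcancel_nat coprime_commute)

lemma q_step_ncong: "[b + q \<noteq> b] (mod p)" "[b \<noteq> b + q] (mod p)"
  using q_steps_cong_iff[of b 1 0] q_steps_cong_iff[of b 0 1] p_gt_2 by (auto simp: cong_def)

lemma q_steps_reach: obtains k where "k < p" "[i = b + k * q] (mod p)"
proof -
  obtain x where x: "[q * x = 1] (mod p)"
    using cong_solve_coprime_nat[of q p] coprime_pq by (auto simp: coprime_commute)
  \<comment> \<open>Here \<open>x\<close> inverts \<open>q\<close> and \<open>(p - 1) * b\<close>
    stands for \<open>-b\<close> modulo \<open>p\<close>, so \<open>k * q\<close> is congruent to
    \<open>i - b\<close>.\<close>
  define k where "k = (x * (i + (p - 1) * b)) mod p"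
  have "[b + k * q = b + (x * (i + (p - 1) * b)) * q] (mod p)"
    unfolding k_def by (intro cong_add cong_mult) auto
  also have "b + (x * (i + (p - 1) * b)) * q = b + (q * x) * (i + (p - 1) * b)"
    by (simp add: algebra_simps)
  also have "[\<dots> = b + 1 * (i + (p - 1) * b)] (mod p)"
    by (intro cong_add cong_mult x) auto
  also have "b + 1 * (i + (p - 1) * b) = i + p * b"
    using p_gt_2 by (cases p) auto
  also have "[\<dots> = i] (mod p)" by (simp add: cong_def)
  finally show ?thesis using that[of k] p_gt_2 by (auto simp: k_def cong_sym)
qed

text \<open>Between \<open>t\<close> and \<open>t + q\<close> the color \<open>g\<close> stays and
  \<open>f\<close> changes, so one of the two is a mismatch. The pairs are disjoint since
  \<open>T\<close> never contains both. The location of \<open>E\<close> is recorded so that a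
  further mismatch can be recognized as new.\<close>

lemma pair_mismatches:
  assumes "periodic g q" "finite T"
    and T: "\<And>t. t \<in> T \<Longrightarrow> t + q < n \<and> f t \<noteq> f (t + q) \<and> t + q \<notin> T"
  obtains E where "E \<subseteq> mismatches n f g" "card E = card T" "E \<subseteq> T \<union> (\<lambda>t. t + q) ` T"
proof -
  define h where "h = (\<lambda>t. if f t \<noteq> g t then t else t + q)"
  have "g (t + q) = g t" for t using assms(1) by (simp add: periodic_def)
  then have "h ` T \<subseteq> mismatches n f g" using T by (fastforce simp: h_def mismatches_def)
  moreover have "inj_on h T"
    using T unfolding h_def inj_on_def by (metis add_right_cancel)
  moreover have "h ` T \<subseteq> T \<union> (\<lambda>t. t + q) ` T" by (auto simp: h_def)
  ultimately show ?thesis using that[of "h ` T"] by (simp add: card_image)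
qed

lemma boundary_cong:
  assumes "periodic f p" "[u = v] (mod p)"
  shows "f u = f v" "f (u + q) = f (v + q)"
  using assms periodic_cong[OF assms(1)] by (auto simp: cong_add_rcancel_nat)

text \<open>Without boundaries \<open>f\<close> would also have period \<open>q\<close>, hence be
  constant, as steps of \<open>q\<close> reach every residue.\<close>

lemma coloring_boundary:
  assumes "coloring n p q f g"
  obtains b where "b < p" "f b \<noteq> f (b + q)"
proof -
  have per: "periodic f p" using assms by (simp add: coloring_def)
  have "\<exists>b. f b \<noteq> f (b + q)"
  proof (rule ccontr)
    assume "\<nexists>b. f b \<noteq> f (b + q)"
    then have "periodic f q" by (simp add: periodic_def)
    then have "f i = f 0" for i
      using q_steps_reach[of i 0] per periodic_mult[of f q 0] periodic_cong by (metis add_0)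
    then show False using assms by (auto simp: coloring_def)
  qed
  then obtain b where "f b \<noteq> f (b + q)" by blast
  then have "f (b mod p) \<noteq> f (b mod p + q)" using boundary_cong[OF per, of "b mod p" b] by simp
  then show ?thesis using that[of "b mod p"] p_gt_2 by simp
qed

text \<open>If all boundaries are at \<open>b - q\<close>, \<open>b\<close> or \<open>b + q\<close>,
  then \<open>f\<close> is constant on \<open>b + 2 * q\<close>, ...,
  \<open>b + (p - 1) * q\<close>. As \<open>f\<close> differs at \<open>b\<close> and
  \<open>b + q\<close>, exactly one of these two deviates from that constant.\<close>

lemma isolated_or_nonadjacent:
  assumes "periodic f p" "f b \<noteq> f (b + q)"
  shows "(\<exists>r \<alpha>. \<forall>i. f i \<noteq> \<alpha> \<longleftrightarrow> [i = r] (mod p)) \<or>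
    (\<exists>u<p. f u \<noteq> f (u + q) \<and> [u \<noteq> b] (mod p) \<and> [u \<noteq> b + q] (mod p) \<and> [u + q \<noteq> b] (mod p))"
proof (rule disjCI)
  assume none: "\<not> (\<exists>u<p. f u \<noteq> f (u + q) \<and> [u \<noteq> b] (mod p) \<and> [u \<noteq> b + q] (mod p) \<and> [u + q \<noteq> b] (mod p))"
  have near: "[u = b] (mod p) \<or> [u = b + q] (mod p) \<or> [u + q = b] (mod p)"
    if "f u \<noteq> f (u + q)" for u
  proof -
    have "u mod p < p" "f (u mod p) \<noteq> f (u mod p + q)"
      using that boundary_cong[OF assms(1), of "u mod p" u] p_gt_2 by auto
    then have "[u mod p = b] (mod p) \<or> [u mod p = b + q] (mod p) \<or> [u mod p + q = b] (mod p)"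
      using none by blast
    then show ?thesis by (simp add: cong_def mod_add_left_eq)
  qed
  define \<alpha> where "\<alpha> = f (b + 2 * q)"
  have const: "2 \<le> k \<Longrightarrow> k < p \<Longrightarrow> f (b + k * q) = \<alpha>" for k
  proof (induction k rule: nat_induct_at_least)
    case base
    then show ?case by (simp add: \<alpha>_def)
  next
    case (Suc k)
    have "[b + k * q \<noteq> b + 0 * q] (mod p)" "[b + k * q \<noteq> b + 1 * q] (mod p)"
      "[b + Suc k * q \<noteq> b + 0 * q] (mod p)"
      unfolding q_steps_cong_iff using Suc p_gt_2 by (auto simp: cong_def)
    then have "f (b + k * q) = f (b + k * q + q)" using near[of "b + k * q"] by (auto simp: algebra_simps)
    then show ?case using Suc by (simp add: algebra_simps)
  qed
  define k0 :: nat where "k0 = (if f b = \<alpha> then 1 else 0)"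
  have k0: "f (b + k * q) \<noteq> \<alpha> \<longleftrightarrow> k = k0" if "k < p" for k
  proof -
    have "k = 0 \<or> k = 1 \<or> 2 \<le> k" by linarith
    then show ?thesis using const[of k] that assms(2) by (auto simp: k0_def)
  qed
  have "f i \<noteq> \<alpha> \<longleftrightarrow> [i = b + k0 * q] (mod p)" for i
  proof -
    obtain k where k: "k < p" "[i = b + k * q] (mod p)" using q_steps_reach .
    have "k0 < p" using p_gt_2 by (simp add: k0_def)
    have "f i \<noteq> \<alpha> \<longleftrightarrow> k = k0" using k k0 periodic_cong[OF assms(1)] by blast
    also have "\<dots> \<longleftrightarrow> [b + k * q = b + k0 * q] (mod p)"
      using k(1) \<open>k0 < p\<close> unfolding q_steps_cong_iff by (simp add: cong_def)
    also have "\<dots> \<longleftrightarrow> [i = b + k0 * q] (mod p)" using k(2) by (metis cong_sym cong_trans)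
    finally show ?thesis .
  qed
  then show "\<exists>r \<alpha>. \<forall>i. f i \<noteq> \<alpha> \<longleftrightarrow> [i = r] (mod p)" by blast
qed

lemma coloring_two_boundaries:
  assumes "coloring n p q f g"
  obtains u v where "u < p" "v < p" "u \<noteq> v" "f u \<noteq> f (u + q)" "f v \<noteq> f (v + q)"
proof -
  have per: "periodic f p" using assms by (simp add: coloring_def)
  obtain b where b: "b < p" "f b \<noteq> f (b + q)" using coloring_boundary[OF assms] .
  from isolated_or_nonadjacent[OF per b(2)] show ?thesis
  proof (elim disjE exE conjE)
    fix r \<alpha> assume iso: "\<forall>i. f i \<noteq> \<alpha> \<longleftrightarrow> [i = r] (mod p)"
    \<comment> \<open>The boundaries are on both sides of the isolated residue; \<open>r'\<close> is
      its predecessor \<open>r - q\<close> on the cycle.\<close>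
    define r' where "r' = r + (p - 1) * q"
    have "r' + q = r + p * q" using p_gt_2 unfolding r'_def by (cases p) auto
    then have "[r' + q = r] (mod p)" by (simp add: cong_def)
    moreover have ne: "[r' \<noteq> r] (mod p)"
      using q_steps_cong_iff[of r "p - 1" 0] p_gt_2 by (simp add: r'_def cong_def)
    ultimately have "f r' \<noteq> f (r' + q)" using iso by blast
    moreover have "f r \<noteq> f (r + q)" using iso q_step_ncong[of r] by (metis cong_refl)
    ultimately have "f (r mod p) \<noteq> f (r mod p + q)" "f (r' mod p) \<noteq> f (r' mod p + q)"
      using boundary_cong[OF per, of "r mod p" r] boundary_cong[OF per, of "r' mod p" r'] by auto
    moreover have "r mod p \<noteq> r' mod p" using ne by (auto simp: cong_def)
    ultimately show ?thesis using that[of "r mod p" "r' mod p"] p_gt_2 by simp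
  next
    fix u assume "u < p" "f u \<noteq> f (u + q)" "[u \<noteq> b] (mod p)"
    then show ?thesis using that[of u b] b by (metis cong_refl)
  qed
qed

section \<open>Lower bounds for the number of mismatches\<close>

text \<open>For \<open>n \<le> 2 * q\<close> every pair starts below \<open>q\<close> and ends at or
  above \<open>q\<close>, so the pairs are disjoint even when the boundaries are consecutive on the
  cycle.\<close>

lemma hs_le_mismatches_short:
  assumes "coloring n p q f g" "n \<le> 2 * q"
  shows "hs n \<le> card (mismatches n f g)"
proof -
  have per: "periodic f p" "periodic g q" using assms(1) by (auto simp: coloring_def)
  obtain u v where uv: "u < p" "v < p" "u \<noteq> v" "f u \<noteq> f (u + q)" "f v \<noteq> f (v + q)"
    using coloring_two_boundaries[OF assms(1)] .
  define T where "T = {t. t < n - q \<and> ([t = u] (mod p) \<or> [t = v] (mod p))}"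
  have "t + q < n \<and> f t \<noteq> f (t + q) \<and> t + q \<notin> T" if "t \<in> T" for t
  proof -
    have "f t \<noteq> f (t + q)"
      using that uv(4,5) boundary_cong[OF per(1), of t u] boundary_cong[OF per(1), of t v]
      unfolding T_def by blast
    then show ?thesis using that assms(2) unfolding T_def by auto
  qed
  moreover have "finite T" by (simp add: T_def)
  ultimately obtain E where "E \<subseteq> mismatches n f g" "card E = card T"
    using pair_mismatches[OF per(2), of T n f] by metis
  then have "card T \<le> card (mismatches n f g)" by (metis card_mono finite_mismatches)
  then show ?thesis using card_two_residues_ge[OF uv(1-3), of "n - q"] by (simp add: T_def)
qed

lemma nonadjacent_mismatches:
  assumes "periodic f p" "periodic g q"
    and "f u \<noteq> f (u + q)" "f v \<noteq> f (v + q)"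
    and "[u \<noteq> v + q] (mod p)" "[u + q \<noteq> v] (mod p)"
  obtains E where "E \<subseteq> mismatches n f g"
    "card E = card {t. t < n - q \<and> ([t = u] (mod p) \<or> [t = v] (mod p))}"
    "\<And>e. e \<in> E \<Longrightarrow> [e = u] (mod p) \<or> [e = v] (mod p) \<or> (\<exists>t. e = t + q \<and> ([t = u] (mod p) \<or> [t = v] (mod p)))"
proof -
  define T where "T = {t. t < n - q \<and> ([t = u] (mod p) \<or> [t = v] (mod p))}"
  have "t + q < n \<and> f t \<noteq> f (t + q) \<and> t + q \<notin> T" if t: "t \<in> T" for t
  proof -
    have "[t + q \<noteq> u] (mod p) \<and> [t + q \<noteq> v] (mod p)"
      using t assms(5,6) q_step_ncong
      unfolding T_def by (smt (verit) cong_add_rcancel_nat cong_sym cong_trans mem_Collect_eq)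
    moreover have "f t \<noteq> f (t + q)"
      using t assms(3,4) boundary_cong[OF assms(1), of t u] boundary_cong[OF assms(1), of t v]
      unfolding T_def by blast
    ultimately show ?thesis using t unfolding T_def by auto
  qed
  moreover have "finite T" by (simp add: T_def)
  ultimately obtain E where "E \<subseteq> mismatches n f g" "card E = card T" "E \<subseteq> T \<union> (\<lambda>t. t + q) ` T"
    using pair_mismatches[OF assms(2), of T n f] by metis
  then show ?thesis using that[of E] by (fastforce simp: T_def)
qed

lemma special_le_isolated:
  assumes "periodic g q" "2 * q \<le> n" "l < n" "g l" and f: "\<And>i. f i \<longleftrightarrow> [i = l] (mod p)"
  shows "sm n l \<le> card (mismatches n f g)"
proof -
  \<comment> \<open>Making \<open>g\<close> false on a column other than that of \<open>l\<close> does not add mismatches: a position of it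
    that is congruent to \<open>l\<close> modulo \<open>p\<close> has a neighbor in the column that is not.\<close>
  have per: "g (i + q) = g i" for i using assms(1) by (simp add: periodic_def)
  have perm: "g (i - q) = g i" if "q \<le> i" for i using per[of "i - q"] that by simp
  have gl: "g i" if "[i = l] (mod q)" for i using periodic_cong[OF assms(1) that] assms(4) by simp
  have two: "\<not> ([i = l] (mod p) \<and> [i + 2 * q = l] (mod p))" for i
    using q_steps_cong_iff[of i 2 0] p_gt_2 by (auto simp: cong_def)
  have one: "\<not> ([i = l] (mod p) \<and> [i + q = l] (mod p))" for i
    using q_steps_cong_iff[of i 1 0] p_gt_2 by (auto simp: cong_def)
  \<comment> \<open>Where \<open>f\<close> and \<open>g\<close> are both true, \<open>h\<close>
    moves by \<open>q\<close>, which makes \<open>f\<close> false and keeps \<open>g\<close> true.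
    The move down is possible because \<open>2 * q \<le> n\<close>.\<close>
  define h where "h = (\<lambda>i. if f i \<and> g i then (if i + q < n then i + q else i - q) else i)"
  have mem: "i < n \<and> (f i \<noteq> [i = l] (mod q))" if "i \<in> special_mismatches p q n l" for i
    using that f by (auto simp: special_mismatches_def mismatches_def)
  have "h ` special_mismatches p q n l \<subseteq> mismatches n f g"
  proof
    fix x assume "x \<in> h ` special_mismatches p q n l"
    then obtain i where i: "i \<in> special_mismatches p q n l" "x = h i" by blast
    note m = mem[OF i(1)]
    consider "f i" "g i" "i + q < n" | "f i" "g i" "\<not> i + q < n" | "\<not> (f i \<and> g i)" by blast
    then show "x \<in> mismatches n f g"
    proof cases
      case 1
      then show ?thesis using i(2) one[of i] per f by (auto simp: h_def mismatches_def)
    next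
      case 2
      then have "q \<le> i" using assms(2) by linarith
      then show ?thesis using 2 i(2) m one[of "i - q"] perm f by (auto simp: h_def mismatches_def)
    next
      case 3
      then show ?thesis using i(2) m gl by (auto simp: h_def mismatches_def)
    qed
  qed
  moreover have "inj_on h (special_mismatches p q n l)"
  proof (rule inj_onI)
    fix i j assume ij: "i \<in> special_mismatches p q n l" "j \<in> special_mismatches p q n l" "h i = h j"
    \<comment> \<open>A moved \<open>i\<close> is not congruent to \<open>l\<close> modulo
      \<open>q\<close>, hence neither is its image, where moreover \<open>f\<close> is false. So the
      image is no special mismatch and differs from every unmoved \<open>j\<close>.\<close>
    have cross: "h i \<noteq> j" if "f i" "g i" "\<not> (f j \<and> g j)" 
      "i \<in> special_mismatches p q n l" "j \<in> special_mismatches p q n l" for i j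
    proof
      assume "h i = j"
      note m = mem[OF that(4)] mem[OF that(5)]
      have "\<not> f j" "g j" "[j = l] (mod q) = [i = l] (mod q)"
      proof -
        have "j = i + q \<or> i = j + q" using \<open>h i = j\<close> that m assms(2) by (auto simp: h_def split: if_splits)
        then show "\<not> f j" "g j" "[j = l] (mod q) = [i = l] (mod q)"
          using that one[of i] one[of j] f per by (auto simp: cong_def)
      qed
      then show False using m that by auto
    qed
    show "i = j"
    proof (cases "(f i \<and> g i) \<and> (f j \<and> g j)")
      case True
      then have "i = j \<or> i = j + 2 * q \<or> j = i + 2 * q"
        using ij(3) assms(2) by (auto simp: h_def split: if_splits)
      then show ?thesis using True two[of i] two[of j] f by auto
    next
      case False
      then show ?thesis using cross[of i j] cross[of j i] ij by (auto simp: h_def split: if_splits)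
    qed
  qed
  ultimately show ?thesis by (metis card_image card_mono finite_mismatches)
qed

text \<open>Comparing both colorings with \<open>\<alpha>\<close> makes the isolated color true; a
  position where both have that color serves as center.\<close>

lemma special_le_mismatches:
  assumes col: "coloring n p q f g" and "2 * q \<le> n" and iso: "\<forall>i. f i \<noteq> \<alpha> \<longleftrightarrow> [i = r] (mod p)"
  shows "\<exists>l<n. sm n l \<le> card (mismatches n f g)"
proof -
  let ?f = "\<lambda>i. f i \<noteq> \<alpha>" and ?g = "\<lambda>i. g i \<noteq> \<alpha>"
  have per: "periodic ?g q" using col by (simp add: coloring_def periodic_def)
  obtain l where l: "l < n" "?f l" "?g l" using col by (cases \<alpha>) (auto simp: coloring_def)
  then have "[l = r] (mod p)" using iso by blast
  then have "?f i \<longleftrightarrow> [i = l] (mod p)" for i using iso by (metis cong_sym cong_trans)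
  then have "sm n l \<le> card (mismatches n ?f ?g)" by (intro special_le_isolated per assms l)
  moreover have "mismatches n ?f ?g = mismatches n f g" by (auto simp: mismatches_def)
  ultimately show ?thesis using l(1) by auto
qed

lemma hs_or_special_le_mismatches:
  assumes col: "coloring n p q f g" and n: "2 * q \<le> n"
  shows "hs n \<le> card (mismatches n f g) \<or> (\<exists>l<n. sm n l \<le> card (mismatches n f g))"
proof -
  have per: "periodic f p" "periodic g q" using col by (auto simp: coloring_def)
  obtain b where b: "b < p" "f b \<noteq> f (b + q)" using coloring_boundary[OF col] .
  from isolated_or_nonadjacent[OF per(1) b(2)] show ?thesis
  proof (elim disjE exE conjE)
    fix r \<alpha> assume "\<forall>i. f i \<noteq> \<alpha> \<longleftrightarrow> [i = r] (mod p)"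
    then show ?thesis using special_le_mismatches[OF col n] by blast
  next
    fix u assume u: "u < p" "f u \<noteq> f (u + q)" "[u \<noteq> b] (mod p)" "[u \<noteq> b + q] (mod p)"
      "[u + q \<noteq> b] (mod p)"
    obtain E where "E \<subseteq> mismatches n f g"
      "card E = card {t. t < n - q \<and> ([t = u] (mod p) \<or> [t = b] (mod p))}"
      using nonadjacent_mismatches[OF per u(2) b(2) u(4,5)] by metis
    moreover have "u \<noteq> b" using u(3) by auto
    ultimately show ?thesis using card_two_residues_ge[OF u(1) b(1), of "n - q"]
      by (metis card_mono finite_mismatches le_trans)
  qed
qed

text \<open>At these lengths \<open>hs n\<close> is only \<open>2 * c - 2\<close>. Either some
  boundary residue is small enough to occur \<open>c\<close> times below \<open>n - q\<close>, or
  all boundaries lie among the last \<open>q - p\<close> residues and one more mismatch can be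
  found.\<close>

lemma mismatches_exceptional:
  assumes col: "coloring n p q f g" and niso: "\<nexists>r \<alpha>. \<forall>i. f i \<noteq> \<alpha> \<longleftrightarrow> [i = r] (mod p)"
    and c: "4 \<le> c" "c * q \<le> n" "n + 2 \<le> q + c * p" "(c + 1) * p \<le> n"
  shows "2 * c - 1 \<le> card (mismatches n f g)"
proof -
  have per: "periodic f p" "periodic g q" using col by (auto simp: coloring_def)
  define d where "d = q - p"
  have q: "q = p + d" "0 < d" using p_less_q by (auto simp: d_def)
  \<comment> \<open>The window \<open>c * q \<le> n \<le> q + c * p - 2\<close> forces
    \<open>q\<close> to be close to \<open>p\<close>.\<close>
  have "c * d + 2 \<le> p + d" using c(2,3) by (simp add: q algebra_simps)
  moreover have "4 * d \<le> c * d" using c(1) by simp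
  ultimately have d: "3 * d + 2 \<le> p" by linarith
  define m where "m = n - q"
  have "q \<le> c * q" using c(1) by simp
  then have qn: "q \<le> n" using c(2) by linarith
  have m: "c * p \<le> m + d" "n = m + q"
    using c(4) qn p_less_q unfolding m_def d_def by simp_all
  have c': "c * p = (c - 1) * p + p" using c(1) by (cases c) auto
  have nonadj: "\<exists>u<p. f u \<noteq> f (u + q) \<and> [u \<noteq> b] (mod p) \<and> [u \<noteq> b + q] (mod p) \<and> [u + q \<noteq> b] (mod p)"
    if "f b \<noteq> f (b + q)" for b
    using isolated_or_nonadjacent[OF per(1) that] niso by blast
  show ?thesis
  proof (cases "\<exists>b<p - d. f b \<noteq> f (b + q)")
    case True
    then obtain b where b: "b < p - d" "f b \<noteq> f (b + q)" by blast
    obtain u where u: "u < p" "f u \<noteq> f (u + q)" "[u \<noteq> b] (mod p)" "[u \<noteq> b + q] (mod p)" "[u + q \<noteq> b] (mod p)"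
      using nonadj[OF b(2)] by blast
    obtain E where E: "E \<subseteq> mismatches n f g"
      "card E = card {t. t < n - q \<and> ([t = u] (mod p) \<or> [t = b] (mod p))}"
      using nonadjacent_mismatches[OF per u(2) b(2) u(4,5)] by metis
    have "u \<noteq> b" using u(3) by auto
    then have "card E = (m + p - 1 - u) div p + (m + p - 1 - b) div p"
      using card_two_residues[of u p b m] u(1) b(1) E(2) m by simp
    \<comment> \<open>A residue below \<open>p - d\<close> has at least \<open>c\<close> members
      among the first \<open>m\<close> positions, one more than is guaranteed for
      \<open>u\<close>.\<close>
    moreover have "c * p \<le> m + p - 1 - b" "(c - 1) * p \<le> m + p - 1 - u"
      using m(1) b(1) u(1) c' d by linarith+
    then have "c \<le> (m + p - 1 - b) div p" "c - 1 \<le> (m + p - 1 - u) div p"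
      using p_gt_2 by (simp_all add: less_eq_div_iff_mult_less_eq)
    ultimately have "2 * c - 1 \<le> card E" by linarith
    then show ?thesis using E(1) by (meson card_mono finite_mismatches le_trans)
  next
    case False
    obtain b where b: "b < p" "f b \<noteq> f (b + q)" using coloring_boundary[OF col] .
    obtain u where u: "u < p" "f u \<noteq> f (u + q)" "[u \<noteq> b] (mod p)" "[u \<noteq> b + q] (mod p)" "[u + q \<noteq> b] (mod p)"
      using nonadj[OF b(2)] by blast
    have late: "p - d \<le> b" "p - d \<le> u" using False b(2) u(2) by (meson not_less)+
    obtain E where E: "E \<subseteq> mismatches n f g"
      "card E = card {t. t < n - q \<and> ([t = u] (mod p) \<or> [t = b] (mod p))}"
      "\<And>e. e \<in> E \<Longrightarrow> [e = u] (mod p) \<or> [e = b] (mod p) \<or> (\<exists>t. e = t + q \<and> ([t = u] (mod p) \<or> [t = b] (mod p)))"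
      using nonadjacent_mismatches[OF per u(2) b(2) u(4,5), of n] by blast
    have "u \<noteq> b" using u(3) by auto
    then have "card E = (m + p - 1 - u) div p + (m + p - 1 - b) div p"
      using card_two_residues[of u p b m] u(1) b(1) E(2) m by simp
    moreover have "(c - 1) * p \<le> m + p - 1 - b" "(c - 1) * p \<le> m + p - 1 - u"
      using m(1) b(1) u(1) c' d by linarith+
    then have "c - 1 \<le> (m + p - 1 - b) div p" "c - 1 \<le> (m + p - 1 - u) div p"
      using p_gt_2 by (simp_all add: less_eq_div_iff_mult_less_eq)
    ultimately have cE: "2 * (c - 1) \<le> card E" by linarith
    \<comment> \<open>The column of \<open>j\<close> starts with the pattern \<open>xxyy\<close>, whose inner pair is the one at the
      boundary \<open>b\<close>; the outer pair yields one more mismatch.\<close>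
    have away: "[y \<noteq> u] (mod p) \<and> [y \<noteq> b] (mod p) \<and> f y = f (y + q)"
      if "y mod p < p - d" for y
    proof -
      have "f (y mod p) = f (y mod p + q)" using False that by blast
      then have "f y = f (y + q)" using boundary_cong[OF per(1), of "y mod p" y] by simp
      then show ?thesis using that late b(1) u(1) by (auto simp: cong_def)
    qed
    \<comment> \<open>Since \<open>q = p + d\<close>, this is the residue preceding \<open>b\<close>
      on the cycle.\<close>
    define j where "j = b - d"
    have jp: "j < p" "j < p - d" using b(1) d q(2) by (auto simp: j_def)
    have "j + 2 * q = (b + d - p) + 3 * p" "j + 3 * q = (b + 2 * d - p) + 4 * p"
      using late d by (auto simp: j_def q)
    then have mods: "(j + 2 * q) mod p = b + d - p" "(j + 3 * q) mod p = b + 2 * d - p"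
      using b(1) d by auto
    have a1: "[j \<noteq> u] (mod p) \<and> [j \<noteq> b] (mod p) \<and> f j = f (j + q)"
      by (rule away) (use jp in simp)
    have a2: "[j + 2 * q \<noteq> u] (mod p) \<and> [j + 2 * q \<noteq> b] (mod p) \<and> f (j + 2 * q) = f (j + 2 * q + q)"
      by (rule away) (use mods b(1) d in linarith)
    have a3: "[j + 3 * q \<noteq> u] (mod p) \<and> [j + 3 * q \<noteq> b] (mod p)"
      using away[of "j + 3 * q"] mods b(1) d by linarith
    have "j + q = b + 1 * p" using late d by (simp add: j_def q)
    then have "f (j + q) \<noteq> f (j + q + q)"
      using b(2) boundary_cong[OF per(1), of "b + 1 * p" b] by (simp add: cong_def)
    moreover have "j + q + q = j + 2 * q" "j + 2 * q + q = j + 3 * q" by simp_all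
    ultimately have fj: "f j \<noteq> f (j + 3 * q)" using a1 a2 by metis
    have "4 * q \<le> c * q" using c(1) by simp
    then have jn: "j + 3 * q < n" using jp p_less_q c(2) by linarith
    have "g (j + 3 * q) = g j" using periodic_mult[OF per(2)] .
    define e where "e = (if f j \<noteq> g j then j else j + 3 * q)"
    have e: "e \<in> mismatches n f g" "e = j \<or> e = j + 3 * q"
      using fj jn \<open>g (j + 3 * q) = g j\<close> by (auto simp: e_def mismatches_def)
    \<comment> \<open>Members of \<open>E\<close> are at a boundary or \<open>q\<close> after one.
      Neither \<open>j\<close> nor \<open>j + 3 * q\<close> nor \<open>j + 2 * q\<close> is a
      boundary, and nothing lies \<open>q\<close> before \<open>j\<close>.\<close>
    have "e \<notin> E"
    proof
      assume "e \<in> E"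
      then obtain t where t: "e = t + q" "[t = u] (mod p) \<or> [t = b] (mod p)"
        using E(3) e(2) a1 a3 by blast
      then have "t = j + 2 * q" using e(2) jp p_less_q by auto
      then show False using t(2) a2 by blast
    qed
    moreover have "finite E" using E(1) finite_mismatches finite_subset by blast
    ultimately have "card (insert e E) = card E + 1" by simp
    moreover have "card (insert e E) \<le> card (mismatches n f g)"
      using E(1) e(1) by (intro card_mono) auto
    ultimately show ?thesis using cE by linarith
  qed
qed

section \<open>Comparison of the two bounds\<close>

lemma q_bounds: "q div p * p < q" "q < (q div p + 1) * p" "1 \<le> q div p" "(q - 1) div p = q div p"
proof -
  have "\<not> p dvd q" using coprime_pq p_gt_2 by (auto dest: coprime_common_divisor_nat[of p q p])
  then have "q mod p \<noteq> 0" by (simp add: dvd_eq_mod_eq_0)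
  moreover have "q = q div p * p + q mod p" by simp
  ultimately show "q div p * p < q" by linarith
  show "q < (q div p + 1) * p" using p_gt_2 by (simp add: dividend_less_div_times)
  show "1 \<le> q div p" using p_less_q p_gt_2 by (simp add: less_eq_div_iff_mult_less_eq)
  have "q - 1 = (q mod p - 1) + q div p * p" using \<open>q = _\<close> \<open>q mod p \<noteq> 0\<close> by linarith
  moreover have "q mod p - 1 < p" using p_gt_2 mod_less_divisor[of p q] by linarith
  ultimately show "(q - 1) div p = q div p" by simp
qed

text \<open>The center \<open>q - 1\<close> ends the first block of \<open>q\<close> positions, so
  nothing precedes it in its class modulo \<open>q\<close>.\<close>

lemma special_last_of_first_row:
  assumes "q \<le> n"
  shows "sm n (q - 1) \<le> q div p + (n - q) div p + (n - q) div q"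
  using card_special_le[of "q - 1" n p q] assms p_gt_2 p_less_q q_bounds(4) by simp

text \<open>The center \<open>q - 1\<close> gives at most \<open>K + M + e\<close> holes, while
  \<open>hs n\<close> is at least \<open>2 * M\<close>. This suffices unless
  \<open>M < K + e\<close>, which forces \<open>K = 1\<close> and \<open>M = e\<close>.\<close>

lemma special_le_mismatches_otherwise:
  assumes col: "coloring n p q f g"
    and n: "q + (q div p + 1) * p \<le> n" "n < 3 * q \<or> q + 3 * p \<le> n"
  shows "\<exists>l<n. sm n l \<le> card (mismatches n f g)"
proof (cases "\<exists>r \<alpha>. \<forall>i. f i \<noteq> \<alpha> \<longleftrightarrow> [i = r] (mod p)")
  case True
  moreover have "2 * q \<le> n" using n(1) q_bounds(2) by linarith
  ultimately show ?thesis using special_le_mismatches[OF col] by blast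
next
  case niso: False
  have "2 * q \<le> n" using n(1) q_bounds(2) by linarith
  define K M e where "K = q div p" and "M = (n - q) div p" and "e = (n - q) div q"
  note K = q_bounds[folded K_def]
  consider "\<exists>l<n. sm n l \<le> card (mismatches n f g)" | "hs n \<le> card (mismatches n f g)"
    using hs_or_special_le_mismatches[OF col \<open>2 * q \<le> n\<close>] by blast
  then show ?thesis
  proof cases
    case 2
    have hs: "2 * M \<le> hs n" by (simp add: M_def div_le_mono)
    have first: "sm n (q - 1) \<le> K + M + e" "q - 1 < n"
      using special_last_of_first_row[of n] \<open>2 * q \<le> n\<close> p_less_q by (auto simp: K_def M_def e_def)
    show ?thesis
    proof (cases "K + e \<le> M")
      case True
      then show ?thesis using first hs 2 by (intro exI[of _ "q - 1"]) linarith
    next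
      case False
      have "K + 1 \<le> M" unfolding M_def using n(1) p_gt_2
        by (simp add: less_eq_div_iff_mult_less_eq K_def)
      then have "e \<noteq> 1" "e \<noteq> 0" using False by auto
      then have "2 \<le> e" by linarith
      then have "2 * q \<le> n - q" unfolding e_def using p_less_q
        by (simp add: less_eq_div_iff_mult_less_eq)
      then have "3 * p \<le> n - q" using n(2) by linarith
      then have M3: "3 \<le> M" unfolding M_def using p_gt_2 by (simp add: less_eq_div_iff_mult_less_eq)
      have eq: "e * q \<le> n - q" by (simp add: e_def)
      moreover have "e * (K * p) \<le> e * q" using K(1) by simp
      ultimately have "e * K * p \<le> n - q" by (simp only: mult.assoc)
      then have eKM: "e * K \<le> M" unfolding M_def using p_gt_2 by (simp add: less_eq_div_iff_mult_less_eq)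
      \<comment> \<open>Otherwise both \<open>K\<close> and \<open>e\<close> are at least 2, and
        \<open>K + e \<le> e * K \<le> M\<close>.\<close>
      have "K = 1"
      proof (rule ccontr)
        assume "K \<noteq> 1"
        then obtain a b where "K = a + 2" "e = b + 2"
          using K(3) \<open>2 \<le> e\<close> by (metis add.commute le_Suc_ex le_antisym not_less_eq_eq one_add_one plus_1_eq_Suc)
        then have "K + e \<le> e * K" by (simp add: algebra_simps)
        then show False using eKM False by linarith
      qed
      then have Me: "M = e" using eKM False by simp
      define c where "c = e + 1"
      have c: "4 \<le> c" using M3 Me by (simp add: c_def)
      have cq: "c * q \<le> n" using eq \<open>2 * q \<le> n\<close> by (simp add: c_def)
      have "n - q < (M + 1) * p" unfolding M_def using p_gt_2 by (simp add: dividend_less_div_times)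
      then have ncp: "n < q + c * p" by (simp add: c_def Me)
      \<comment> \<open>The two bounds now differ by one. The center \<open>p - 1\<close> saves a
        hole in the first case, the second quotient of \<open>hs\<close> gains one in the second,
        and the third needs the additional mismatch.\<close>
      consider "n < (c + 1) * p" | "n + 1 = q + c * p" | "(c + 1) * p \<le> n" "n + 2 \<le> q + c * p"
        using ncp by linarith
      then show ?thesis
      proof cases
        case 1
        have "n - p < (e + 1) * p" "n - p < (e + 1) * q"
        proof -
          show "n - p < (e + 1) * p" using 1 by (simp add: c_def)
          moreover have "(e + 1) * p \<le> (e + 1) * q" using p_less_q by (intro mult_le_mono2) simp
          ultimately show "n - p < (e + 1) * q" by linarith
        qed
        then have "(n - p) div p \<le> e" "(n - p) div q \<le> e"
          using p_gt_2 p_less_q by (simp_all add: less_mult_imp_div_less less_Suc_eq_le[symmetric])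
        moreover have "p - 1 < n" using \<open>2 * q \<le> n\<close> p_less_q by linarith
        ultimately have "sm n (p - 1) \<le> 2 * e"
          using card_special_le[of "p - 1" n p q] p_gt_2 p_less_q by simp
        then show ?thesis using \<open>p - 1 < n\<close> hs 2 Me by (intro exI[of _ "p - 1"]) linarith
      next
        case 2
        then have "n - q + 1 = c * p" using \<open>2 * q \<le> n\<close> by linarith
        then have "(n - q + 1) div p = c" using p_gt_2 by simp
        then have "hs n = e + c" using Me by (simp add: M_def)
        then show ?thesis using first \<open>K = 1\<close> Me \<open>hs n \<le> _\<close>
          by (intro exI[of _ "q - 1"]) (simp add: c_def)
      next
        case 3
        have "2 * c - 1 \<le> card (mismatches n f g)"
          using mismatches_exceptional[OF col niso c cq] 3 by simp
        then show ?thesis using first \<open>K = 1\<close> Me by (intro exI[of _ "q - 1"]) (simp add: c_def)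
      qed
    qed
  qed blast
qed

abbreviation standard_range :: "nat \<Rightarrow> bool" where
  "standard_range n \<equiv> n < q + (q div p + 1) * p \<or> 3 * q \<le> n \<and> n < q + 3 * p"

text \<open>By \<open>card_special_ge\<close> this is a comparison of quotients. At the last length
  of each range the second quotient of \<open>hs\<close> jumps by one, and \<open>n div p\<close> is
  then large enough to compensate.\<close>

lemma hs_le_special:
  assumes "2 * q \<le> n" "standard_range n" "l < n"
  shows "hs n \<le> sm n l"
proof -
  have mult: "k \<le> m div p" if "k * p \<le> m" for k m
    using that p_gt_2 by (simp add: less_eq_div_iff_mult_less_eq)
  have multq: "k \<le> m div q" if "k * q \<le> m" for k m
    using that p_less_q by (simp add: less_eq_div_iff_mult_less_eq)
  have lt: "m div p \<le> k" if "m < (k + 1) * p" for k m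
    using that p_gt_2 by (simp add: less_mult_imp_div_less less_Suc_eq_le[symmetric])
  define K where "K = q div p"
  note K = q_bounds[folded K_def]
  have "n \<le> p * q \<and> hs n + 2 \<le> n div p + n div q"
  proof (cases "n < q + (K + 1) * p")
    case True
    have "3 * q \<le> p * q" using p_gt_2 by simp
    moreover have "(K + 1) * p = K * p + p" by simp
    ultimately have "n \<le> p * q" using True K(1) p_less_q by linarith
    moreover have "(n - q) div p \<le> K" "2 \<le> n div q"
      using True assms(1) by (auto intro!: lt multq)
    moreover have "(n - q + 1) div p + K \<le> n div p"
    proof (cases "n + 1 = q + (K + 1) * p")
      case True
      then have "n - q + 1 = (K + 1) * p" using assms(1) p_less_q by linarith
      then have "(n - q + 1) div p = K + 1" using p_gt_2 by simp
      moreover have "2 * K + 1 \<le> n div p"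
        using True K(1) by (intro mult) (simp add: algebra_simps)
      ultimately show ?thesis by simp
    next
      case False
      then have "(n - q + 1) div p \<le> K" using True assms(1) by (intro lt) linarith
      moreover have "2 * K \<le> n div p"
        using assms(1) K(1) by (intro mult) (simp add: algebra_simps)
      ultimately show ?thesis by simp
    qed
    ultimately show ?thesis by linarith
  next
    case False
    then have n: "3 * q \<le> n" "n < q + 3 * p" using assms(2) by (auto simp: K_def)
    have "n \<le> p * q"
    \<comment> \<open>For \<open>4 \<le> p\<close> the bound \<open>n < 4 * q\<close> suffices; for
      \<open>p = 3\<close>, \<open>n < q + 9\<close> and \<open>3 < q\<close> give
      \<open>n \<le> 3 * q\<close>.\<close>
    proof (cases "p = 3")
      case True
      then show ?thesis using n p_less_q by simp
    next
      case False
      then have "4 * q \<le> p * q" using p_gt_2 by simp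
      then show ?thesis using n p_less_q by linarith
    qed
    moreover have "(n - q) div p \<le> 2" "3 \<le> n div q"
      using n by (auto intro!: lt multq)
    moreover have "(n - q + 1) div p + 1 \<le> n div p"
    proof (cases "n + 1 = q + 3 * p")
      case True
      then have "n - q + 1 = 3 * p" using assms(1) p_less_q by linarith
      then have "(n - q + 1) div p = 3" using p_gt_2 by simp
      moreover have "4 \<le> n div p" using True p_less_q by (intro mult) linarith
      ultimately show ?thesis by simp
    next
      case False
      then have "(n - q + 1) div p \<le> 2" using n p_less_q by (intro lt) auto
      moreover have "3 \<le> n div p" using n p_less_q by (intro mult) linarith
      ultimately show ?thesis by simp
    qed
    ultimately show ?thesis by linarith
  qed
  then show ?thesis
    using card_special_ge[of l n p q] assms(3) p_gt_2 p_less_q coprime_pq by linarith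
qed

section \<open>Upper bounds\<close>

text \<open>Along the cycle of residues \<open>p - 2\<close>, \<open>p - 2 + q\<close>, \<open>p - 2 + 2q\<close>, ... modulo \<open>p\<close>, the
  coloring is true exactly on the arc that follows \<open>p - 2\<close> and ends in \<open>p - 1\<close>.\<close>
lemma arc_coloring:
  obtains f where "periodic f p"
    "\<And>t. f t \<noteq> f (t + q) \<longleftrightarrow> [t = p - 1] (mod p) \<or> [t = p - 2] (mod p)"
proof -
  obtain x where x: "[q * x = 1] (mod p)"
    using cong_solve_coprime_nat[of q p] coprime_pq by (auto simp: coprime_commute)
  define w where "w = x mod p"
  have w: "[q * w = 1] (mod p)" using x by (simp add: w_def cong_def mod_mult_right_eq)
  have wp: "w < p" using p_gt_2 by (simp add: w_def)
  have wpos: "w \<noteq> 0"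
  proof
    assume "w = 0"
    then show False using w p_gt_2 by (simp add: cong_def)
  qed
  have cop: "coprime w p"
    using w by (metis coprime_iff_invertible_nat mult.commute One_nat_def)
  \<comment> \<open>As \<open>w\<close> inverts \<open>q\<close> and \<open>i + 2\<close> is
    \<open>i - (p - 2)\<close> modulo \<open>p\<close>, \<open>k i\<close> is the number of steps
    from \<open>p - 2\<close> to \<open>i\<close> on the cycle; it is \<open>w\<close> for
    \<open>p - 1\<close>.\<close>
  define k where "k = (\<lambda>i. ((i + 2) * w) mod p)"
  define f where "f = (\<lambda>i. 1 \<le> k i \<and> k i \<le> w)"
  have kp: "k i < p" for i using p_gt_2 by (simp add: k_def)
  have kq: "k (i + q) = (k i + 1) mod p" for i
  proof -
    have "(i + q + 2) * w = (i + 2) * w + q * w" by (simp add: algebra_simps)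
    also have "[\<dots> = (i + 2) * w + 1] (mod p)" by (intro cong_add w) auto
    finally show ?thesis unfolding k_def cong_def by (simp only: mod_add_left_eq)
  qed
  have k0: "k i = 0 \<longleftrightarrow> [i = p - 2] (mod p)" for i
  proof -
    have "k i = 0 \<longleftrightarrow> [(i + 2) * w = p * w] (mod p)" by (simp add: k_def cong_def)
    also have "\<dots> \<longleftrightarrow> [i + 2 = p] (mod p)" using cop by (simp only: cong_mult_rcancel_nat)
    also have "\<dots> \<longleftrightarrow> [i + 2 = (p - 2) + 2] (mod p)"
      using p_gt_2 by (simp only: le_add_diff_inverse2 less_imp_le)
    also have "\<dots> \<longleftrightarrow> [i = p - 2] (mod p)" by (rule cong_add_rcancel_nat)
    finally show ?thesis .
  qed
  have k1: "k i = w \<longleftrightarrow> [i = p - 1] (mod p)" for i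
  proof -
    have "k i = w \<longleftrightarrow> [(i + 2) * w = (p + 1) * w] (mod p)" using wp by (simp add: k_def cong_def)
    also have "\<dots> \<longleftrightarrow> [i + 2 = p + 1] (mod p)"
      using cop by (simp only: cong_mult_rcancel_nat)
    also have "p + 1 = (p - 1) + 2" using p_gt_2 by simp
    also have "[i + 2 = (p - 1) + 2] (mod p) \<longleftrightarrow> [i = p - 1] (mod p)" by (rule cong_add_rcancel_nat)
    finally show ?thesis .
  qed
  have "k (i + p) = k i" for i
  proof -
    have "(i + p + 2) * w = (i + 2) * w + w * p" by (simp add: algebra_simps)
    then show ?thesis unfolding k_def by (simp only: mod_mult_self1)
  qed
  then have "periodic f p" by (simp add: periodic_def f_def)
  moreover have "f t \<noteq> f (t + q) \<longleftrightarrow> [t = p - 1] (mod p) \<or> [t = p - 2] (mod p)" for t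
  proof -
    have "f t \<noteq> f (t + q) \<longleftrightarrow> k t = w \<or> k t = 0"
    proof (cases "k t = p - 1")
      case True
      then show ?thesis using kq[of t] wp p_gt_2 unfolding f_def by auto
    next
      case False
      then have "k (t + q) = k t + 1" using kp[of t] kq[of t] by simp
      then show ?thesis using wpos unfolding f_def by auto
    qed
    then show ?thesis by (simp only: k0 k1)
  qed
  ultimately show ?thesis by (rule that)
qed

lemma card_arc_boundaries:
  assumes "A \<subseteq> h ` {t. t < n - q \<and> ([t = p - 1] (mod p) \<or> [t = p - 2] (mod p))}"
  shows "card A \<le> hs n"
proof -
  have "card A \<le> card {t. t < n - q \<and> ([t = p - 1] (mod p) \<or> [t = p - 2] (mod p))}"
    using surj_card_le[OF _ assms] by simp
  then show ?thesis using card_last_two_residues[of p "n - q"] p_gt_2 by simp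
qed

text \<open>Here \<open>g\<close> copies \<open>f\<close> from the first block of \<open>q\<close>
  positions. Every mismatch comes \<open>q\<close> after a boundary: in the third block this holds
  because \<open>n\<close> stops it before the residue \<open>p - 2\<close>, so the first step down
  the column is not a boundary.\<close>

lemma coloring_hs_first_range:
  assumes n: "q \<le> n" "n < q + (q div p + 1) * p"
  obtains f g where "coloring n p q f g" "card (mismatches n f g) \<le> hs n"
proof -
  obtain f where per: "periodic f p" and
    f: "\<And>t. f t \<noteq> f (t + q) \<longleftrightarrow> [t = p - 1] (mod p) \<or> [t = p - 2] (mod p)" using arc_coloring by metis
  define g where "g = (\<lambda>i. f (i mod q))"
  have low: "f t = f (t + q)" if "t + 2 < p" for t
    using f[of t] that by (auto simp: cong_def)
  have "mismatches n f g \<subseteq> (\<lambda>t. t + q) ` {t. t < n - q \<and> ([t = p - 1] (mod p) \<or> [t = p - 2] (mod p))}"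
  proof
    fix i assume "i \<in> mismatches n f g"
    then have i: "i < n" "f i \<noteq> f (i mod q)" by (auto simp: mismatches_def g_def)
    have "q \<le> i" using i(2) by (metis mod_less not_less)
    have "f (i - q) \<noteq> f (i - q + q)"
    proof (cases "i < 2 * q")
      case True
      then have "i mod q = i - q" using \<open>q \<le> i\<close> mod_eq_diff_mult[of 1 q i] by simp
      then show ?thesis using i \<open>q \<le> i\<close> by simp
    next
      case False
      have "i < 3 * q" using i(1) n(2) q_bounds(1) p_less_q by simp
      then have "i mod q = i - 2 * q" using False mod_eq_diff_mult[of 2 q i] by simp
      moreover have "i - 2 * q + 2 < p" using i(1) n(2) q_bounds(1) False by simp
      then have "f (i - 2 * q) = f (i - 2 * q + q)" by (rule low)
      ultimately show ?thesis using i False by simp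
    qed
    then show "i \<in> (\<lambda>t. t + q) ` {t. t < n - q \<and> ([t = p - 1] (mod p) \<or> [t = p - 2] (mod p))}"
      using f[of "i - q"] i(1) \<open>q \<le> i\<close> by (intro image_eqI[of _ _ "i - q"]) auto
  qed
  then have "card (mismatches n f g) \<le> hs n" by (rule card_arc_boundaries)
  moreover have "coloring n p q f g"
  proof -
    \<comment> \<open>Both \<open>p - 2\<close> and \<open>q - 2\<close> are in the first block,
      where \<open>g\<close> agrees with \<open>f\<close>.\<close>
    have "f (p - 2) \<noteq> f (p - 2 + q)" using f[of "p - 2"] by (metis cong_refl)
    also have "p - 2 + q = q - 2 + p" using p_gt_2 p_less_q by simp
    also have "f \<dots> = f (q - 2)" using per by (simp add: periodic_def)
    finally have ne: "f (p - 2) \<noteq> f (q - 2)" .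
    have agree: "g i = f i" if "i < q" for i using that by (simp add: g_def)
    have "p - 2 < q" "q - 2 < q" using p_less_q p_gt_2 by auto
    then show ?thesis
      using per agree ne n(1) by (intro coloringI[of f p g q "p - 2" n "q - 2"]) (auto simp: periodic_def g_def)
  qed
  ultimately show ?thesis using that by blast
qed

text \<open>Here \<open>g\<close> copies \<open>f\<close> from the second block, which thus has no
  mismatch. Mismatches in the first block are boundaries and later ones come \<open>q\<close> after
  a boundary; \<open>?h\<close> skips the second block accordingly.\<close>

lemma coloring_hs_second_range:
  assumes n: "3 * q \<le> n" "n < q + 3 * p"
  obtains f g where "coloring n p q f g" "card (mismatches n f g) \<le> hs n"
proof -
  obtain f where per: "periodic f p" and
    f: "\<And>t. f t \<noteq> f (t + q) \<longleftrightarrow> [t = p - 1] (mod p) \<or> [t = p - 2] (mod p)" using arc_coloring by metis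
  define g where "g = (\<lambda>i. f (i mod q + q))"
  let ?T = "{t. t < n - q \<and> ([t = p - 1] (mod p) \<or> [t = p - 2] (mod p))}"
  let ?h = "\<lambda>t. if t < q then t else t + q"
  have "mismatches n f g \<subseteq> ?h ` ?T"
  proof
    fix i assume "i \<in> mismatches n f g"
    then have i: "i < n" "f i \<noteq> f (i mod q + q)" by (auto simp: mismatches_def g_def)
    have "i < 4 * q" using i(1) n p_less_q by linarith
    then consider "i < q" | "q \<le> i" "i < 2 * q" | "2 * q \<le> i" "i < 3 * q" | "3 * q \<le> i" "i < 4 * q"
      by linarith
    then show "i \<in> ?h ` ?T"
    proof cases
      case 1
      then have "i \<in> ?T" using i f[of i] n p_less_q by auto
      then show ?thesis using 1 by (intro image_eqI[of _ _ i]) auto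
    next
      case 2
      then have "i mod q + q = i" using mod_eq_diff_mult[of 1 q i] by simp
      then show ?thesis using i(2) by simp
    next
      case 3
      then have "i mod q + q = i - q" using mod_eq_diff_mult[of 2 q i] by simp
      then have "i - q \<in> ?T" using i f[of "i - q"] 3 by auto
      then show ?thesis using 3 by (intro image_eqI[of _ _ "i - q"]) auto
    next
      case 4
      then have eq: "i mod q + q = i - 2 * q" using mod_eq_diff_mult[of 3 q i] by simp
      \<comment> \<open>These bounds keep the residue of \<open>i - 2 * q\<close> below
        \<open>p - 2\<close>, away from both boundaries.\<close>
      have "i - 2 * q + 2 < 2 * p" "p \<le> i - 2 * q" using 4 i(1) n p_less_q by linarith+
      then have "[i - 2 * q \<noteq> p - 1] (mod p)" "[i - 2 * q \<noteq> p - 2] (mod p)"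
        using p_gt_2 by (auto simp: cong_def mod_if)
      then have "f (i - 2 * q) = f (i - 2 * q + q)" using f by blast
      then have "f (i - q) \<noteq> f (i - q + q)" using i(2) eq 4 by simp
      then have "i - q \<in> ?T" using i f[of "i - q"] 4 by auto
      then show ?thesis using 4 by (intro image_eqI[of _ _ "i - q"]) auto
    qed
  qed
  then have "card (mismatches n f g) \<le> hs n" by (rule card_arc_boundaries)
  moreover have "coloring n p q f g"
  proof -
    have "f (p - 2 + p) = f (p - 2)" using per by (simp add: periodic_def)
    then have ne: "f (p - 2 + p) \<noteq> f (p - 2 + q)" using f[of "p - 2"] by (metis cong_refl)
    have agree: "g i = f i" if "q \<le> i" "i < 2 * q" for i
      using that mod_eq_diff_mult[of 1 q i] by (simp add: g_def)
    have "q \<le> p - 2 + p" "p - 2 + p < 2 * q" "q \<le> p - 2 + q" "p - 2 + q < 2 * q"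
      using n p_less_q p_gt_2 by linarith+
    then show ?thesis
      using per agree ne n(1)
      by (intro coloringI[of f p g q "p - 2 + p" n "p - 2 + q"]) (auto simp: periodic_def g_def)
  qed
  ultimately show ?thesis using that by blast
qed

lemma coloring_special:
  assumes "l < n" "2 \<le> n"
  shows "coloring n p q (\<lambda>i. [i = l] (mod p)) (\<lambda>i. [i = l] (mod q))"
proof -
  define j where "j = (if l = 0 then 1 else l - 1)"
  have "[Suc k \<noteq> k] (mod r)" if "2 < r" for k r :: nat
  proof -
    have "[k + 1 \<noteq> k + 0] (mod r)" unfolding cong_add_lcancel_nat using that by (simp add: cong_def)
    then show ?thesis by simp
  qed
  then have "[j \<noteq> l] (mod p)" "[j \<noteq> l] (mod q)"
    using p_gt_2 p_less_q by (cases l; auto simp: j_def cong_sym_eq)+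
  moreover have "j < n" using assms by (auto simp: j_def)
  ultimately show ?thesis
    using assms(1) periodic_cong_const unfolding coloring_def by (metis cong_refl)
qed

end

section \<open>The functions H and L\<close>

lemma less_H_iff:
  "enat h < H \<Sigma> n p q \<longleftrightarrow> (\<forall>X\<in>pwords \<Sigma> n.
     holes X \<le> h \<and> has_period \<Sigma> X p \<and> has_period \<Sigma> X q \<longrightarrow> has_period \<Sigma> X (gcd p q))"
proof
  assume less: "enat h < H \<Sigma> n p q"
  show "\<forall>X\<in>pwords \<Sigma> n.
     holes X \<le> h \<and> has_period \<Sigma> X p \<and> has_period \<Sigma> X q \<longrightarrow> has_period \<Sigma> X (gcd p q)"
  proof (intro ballI impI, rule ccontr)
    fix X assume X: "X \<in> pwords \<Sigma> n" "holes X \<le> h \<and> has_period \<Sigma> X p \<and> has_period \<Sigma> X q"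
      "\<not> has_period \<Sigma> X (gcd p q)"
    then have "H \<Sigma> n p q \<le> enat (holes X)"
      unfolding H_def by (intro Inf_lower) blast
    also have "\<dots> \<le> enat h" using X(2) by simp
    finally show False using less by simp
  qed
next
  assume "\<forall>X\<in>pwords \<Sigma> n.
     holes X \<le> h \<and> has_period \<Sigma> X p \<and> has_period \<Sigma> X q \<longrightarrow> has_period \<Sigma> X (gcd p q)"
  then have "enat (Suc h) \<le> H \<Sigma> n p q"
    unfolding H_def by (intro Inf_greatest) (auto simp: Suc_le_eq not_le[symmetric])
  then show "enat h < H \<Sigma> n p q" by (meson enat_ord_simps(2) lessI less_le_trans)
qed

lemma L_eq: "L \<Sigma> h p q = Inf {enat n0 | n0. \<forall>n\<ge>n0. enat h < H \<Sigma> n p q}"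
  unfolding L_def less_H_iff ..

locale coprime_periods_alphabet = coprime_periods +
  fixes \<Sigma> :: "'a set" and a b :: 'a
  assumes letters: "a \<in> \<Sigma>" "b \<in> \<Sigma>" "a \<noteq> b"
begin

lemma Hs_eq: "q \<le> n \<Longrightarrow> Hs n p q = int (hs n)"
proof -
  assume "q \<le> n"
  then have "real n - real q = real (n - q)" "real n - real q + 1 = real (n - q + 1)" by auto
  then have "\<lfloor>(real n - real q) / real p\<rfloor> = int ((n - q) div p)"
    "\<lfloor>(real n - real q + 1) / real p\<rfloor> = int ((n - q + 1) div p)"
    by (simp_all only: floor_divide_of_nat_eq)
  then show ?thesis by (simp add: Hs_def)
qed

lemma ceiling_ratio: "\<lceil>real q / real p\<rceil> = int (q div p) + 1"
proof -
  have "real (q div p * p) < real q" "real q < real ((q div p + 1) * p)"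
    using q_bounds(1,2) by (simp_all only: of_nat_less_iff)
  then have "real (q div p) < real q / real p" "real q / real p < real (q div p) + 1"
    using p_gt_2 by (simp_all add: field_simps)
  then show ?thesis by (intro ceiling_unique) auto
qed

lemma hs_mono: "n \<le> n' \<Longrightarrow> hs n \<le> hs n'"
  by (intro add_mono div_le_mono) auto

lemma le_hs: "q + k * p \<le> n \<Longrightarrow> 2 * k \<le> hs n"
proof -
  assume "q + k * p \<le> n"
  then have "k \<le> (n - q) div p" "k \<le> (n - q + 1) div p"
    using p_gt_2 by (simp_all add: less_eq_div_iff_mult_less_eq)
  then show ?thesis by linarith
qed

text \<open>Just before \<open>q + k * p\<close> the second quotient has already reached
  \<open>k\<close> and the first is still \<open>k - 1\<close>.\<close>

lemma hs_at: "1 \<le> k \<Longrightarrow> hs (q + k * p - 1) = 2 * k - 1"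
proof -
  assume k: "1 \<le> k"
  then obtain k' where k': "k = Suc k'" by (cases k) auto
  have "q + k * p - 1 - q = (p - 1) + k' * p" "q + k * p - 1 - q + 1 = k * p"
    using p_gt_2 by (auto simp: k')
  then have "hs (q + k * p - 1) = ((p - 1) + k' * p) div p + k * p div p" by (simp only:)
  also have "\<dots> = k' + k" using p_gt_2 div_mult_self1[of p "p - 1" k'] by simp
  finally show ?thesis by (simp add: k')
qed

lemma H_le: "coloring n p q f g \<Longrightarrow> card (mismatches n f g) \<le> k \<Longrightarrow> H \<Sigma> n p q \<le> enat k"
  using H_le_card_mismatches[OF letters coprime_pq, of n f g] p_gt_2 p_less_q
  by (meson enat_ord_simps(1) less_trans order_trans zero_less_numeral)

lemma Hd_le: "l < n \<Longrightarrow> sm n l \<le> k \<Longrightarrow> Hd \<Sigma> n p q \<le> enat k"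
  using Hd_le_card[OF letters, of l n p q] by (meson enat_ord_simps(1) order_trans)

lemma H_ge: "(\<And>f g. coloring n p q f g \<Longrightarrow> k \<le> enat (card (mismatches n f g))) \<Longrightarrow> k \<le> H \<Sigma> n p q"
  using le_H[of \<Sigma> p q n k] letters(1) coprime_pq by blast

lemma Hd_ge_hs: "2 * q \<le> n \<Longrightarrow> standard_range n \<Longrightarrow> enat (hs n) \<le> Hd \<Sigma> n p q"
  by (rule le_Hd) (use hs_le_special in simp)

lemma H_le_Hd: "2 \<le> n \<Longrightarrow> H \<Sigma> n p q \<le> Hd \<Sigma> n p q"
proof (rule le_Hd)
  fix l assume "2 \<le> n" "l < n"
  then show "H \<Sigma> n p q \<le> enat (sm n l)"
    using coloring_special by (intro H_le) (auto simp: special_mismatches_def)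
qed

lemma H_standard:
  assumes "q \<le> n" "standard_range n"
  shows "H \<Sigma> n p q = enat (hs n)"
proof (rule antisym)
  show "H \<Sigma> n p q \<le> enat (hs n)"
    using coloring_hs_first_range[of n] coloring_hs_second_range[of n] assms H_le by metis
  show "enat (hs n) \<le> H \<Sigma> n p q"
  proof (rule H_ge)
    fix f g assume col: "coloring n p q f g"
    show "enat (hs n) \<le> enat (card (mismatches n f g))"
    \<comment> \<open>Beyond \<open>2 * q\<close> a special word may be the alternative bound, and
      in this range it has at least \<open>hs n\<close> holes.\<close>
    proof (cases "n \<le> 2 * q")
      case True
      then show ?thesis using hs_le_mismatches_short[OF col] by simp
    next
      case False
      then have "2 * q \<le> n" by simp
      then show ?thesis
        using hs_or_special_le_mismatches[OF col] hs_le_special[OF _ assms(2)] le_trans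
        unfolding enat_ord_simps(1) by metis
    qed
  qed
qed

lemma H_otherwise:
  assumes "\<not> standard_range n"
  shows "H \<Sigma> n p q = Hd \<Sigma> n p q"
proof (rule antisym)
  have n: "q + (q div p + 1) * p \<le> n" "n < 3 * q \<or> q + 3 * p \<le> n" using assms by auto
  show "H \<Sigma> n p q \<le> Hd \<Sigma> n p q"
    using n(1) p_gt_2 p_less_q by (intro H_le_Hd) linarith
  show "Hd \<Sigma> n p q \<le> H \<Sigma> n p q"
  proof (rule H_ge)
    fix f g assume "coloring n p q f g"
    then obtain l where "l < n" "sm n l \<le> card (mismatches n f g)"
      using special_le_mismatches_otherwise n by blast
    then show "Hd \<Sigma> n p q \<le> enat (card (mismatches n f g))" by (rule Hd_le)
  qed
qed

lemma H_formula:
  assumes "p + q - 2 \<le> n"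
  shows "H \<Sigma> n p q =
    (if int n \<le> int q + int p * \<lceil>real q / real p\<rceil> - 1 \<or>
        (3 * int q \<le> int n \<and> int n \<le> int q + 3 * int p - 1)
     then enat (nat (Hs n p q)) else Hd \<Sigma> n p q)"
proof -
  have n: "q \<le> n" using assms p_gt_2 by linarith
  have "int p * (int (q div p) + 1) = int ((q div p + 1) * p)" by (simp add: algebra_simps)
  then have "int n \<le> int q + int p * \<lceil>real q / real p\<rceil> - 1 \<longleftrightarrow> n < q + (q div p + 1) * p"
    unfolding ceiling_ratio by linarith
  moreover have "3 * int q \<le> int n \<and> int n \<le> int q + 3 * int p - 1 \<longleftrightarrow> 3 * q \<le> n \<and> n < q + 3 * p"
    by linarith
  ultimately show ?thesis
    using H_standard[OF n] H_otherwise[of n] unfolding Hs_eq[OF n] nat_int by argo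
qed

section \<open>From \<open>H\<close> to \<open>L\<close>\<close>

text \<open>Monotonicity of \<open>hs\<close> reduces the condition on all \<open>n \<ge> n0\<close>
  to \<open>n0\<close> itself, and \<open>hs q = 0\<close> forces \<open>n0\<close> to be at least
  \<open>q\<close>.\<close>

lemma L_eq_Ls:
  assumes step: "\<And>n. q \<le> n \<Longrightarrow> enat h < H \<Sigma> n p q \<longleftrightarrow> h < hs n"
  shows "L \<Sigma> h p q = Ls h p q"
proof -
  have "(\<forall>n\<ge>n0. enat h < H \<Sigma> n p q) \<longleftrightarrow> q \<le> n0 \<and> Hs n0 p q > int h" for n0
  proof
    assume all: "\<forall>n\<ge>n0. enat h < H \<Sigma> n p q"
    have "hs q = 0" using p_gt_2 by simp
    then have "\<not> enat h < H \<Sigma> q p q" using step[of q] by simp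
    then have "q \<le> n0" using all by (meson nat_le_linear)
    then show "q \<le> n0 \<and> Hs n0 p q > int h" using all step[of n0] Hs_eq[of n0] by simp
  next
    assume n0: "q \<le> n0 \<and> Hs n0 p q > int h"
    then have "h < hs n0" using Hs_eq[of n0] by simp
    then show "\<forall>n\<ge>n0. enat h < H \<Sigma> n p q"
      using n0 step hs_mono by (meson le_trans less_le_trans)
  qed
  then show ?thesis unfolding L_eq Ls_def by simp
qed

lemma L_eq_Ld:
  assumes step: "\<And>n. 1 \<le> n \<Longrightarrow> enat h < Hd \<Sigma> n p q \<Longrightarrow> enat h < H \<Sigma> n p q"
  shows "L \<Sigma> h p q = Ld \<Sigma> h p q"
proof -
  have "(\<forall>n\<ge>n0. enat h < H \<Sigma> n p q) \<longleftrightarrow> 1 \<le> n0 \<and> Hd \<Sigma> n0 p q > enat h" for n0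
  proof
    assume all: "\<forall>n\<ge>n0. enat h < H \<Sigma> n p q"
    \<comment> \<open>The special word of length 2 has no holes, so \<open>n0\<close> exceeds 2 and
      \<open>H_le_Hd\<close> applies to it.\<close>
    have "sm 2 0 \<le> h" using card_special_le[of 0 2 p q] p_gt_2 p_less_q by simp
    then have "H \<Sigma> 2 p q \<le> enat h" using H_le_Hd[of 2] Hd_le[of 0 2 h] by (meson le_refl order_trans zero_less_numeral)
    then have "\<not> n0 \<le> 2" using all by (meson not_less)
    then have "2 \<le> n0" by simp
    then show "1 \<le> n0 \<and> Hd \<Sigma> n0 p q > enat h"
      using all H_le_Hd[of n0] by (meson le_refl less_le_trans one_le_numeral order_trans)
  next
    assume "1 \<le> n0 \<and> Hd \<Sigma> n0 p q > enat h"
    then show "\<forall>n\<ge>n0. enat h < H \<Sigma> n p q"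
      using step Hd_mono[OF letters] by (meson le_trans less_le_trans)
  qed
  then show ?thesis unfolding L_eq Ld_def by simp
qed

text \<open>The hypothesis gives \<open>h \<le> 2 * (q div p)\<close>. Beyond the first range both
  sides hold outside the standard range: \<open>hs\<close> exceeds \<open>h\<close> at the last
  length \<open>n1\<close> of the first range, and \<open>Hd\<close> carries this on by
  monotonicity.\<close>

lemma less_H_iff_less_hs:
  assumes h: "p * ((h + 1) div 2) < q" and n: "q \<le> n"
  shows "enat h < H \<Sigma> n p q \<longleftrightarrow> h < hs n"
proof (cases "standard_range n")
  case True
  then show ?thesis using H_standard[OF n] by simp
next
  case False
  have "(h + 1) div 2 \<le> q div p"
    using h p_gt_2 by (simp add: less_eq_div_iff_mult_less_eq mult.commute)
  then have "2 * ((h + 1) div 2) \<le> 2 * (q div p)" by (rule mult_le_mono2)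
  moreover have "h \<le> 2 * ((h + 1) div 2)" by auto
  ultimately have "h \<le> 2 * (q div p)" by (rule order_trans[rotated])
  then have hK: "h < 2 * (q div p + 1) - 1" by simp
  have range: "q + (q div p + 1) * p \<le> n" using False by auto
  define n1 where "n1 = q + (q div p + 1) * p - 1"
  have n1: "2 * q \<le> n1" "standard_range n1" "n1 \<le> n" using range q_bounds(2) by (auto simp: n1_def)
  have "hs n1 = 2 * (q div p + 1) - 1" unfolding n1_def by (rule hs_at) simp
  then have "enat h < enat (hs n1)" using hK by simp
  also have "\<dots> \<le> Hd \<Sigma> n1 p q" using Hd_ge_hs n1 by blast
  also have "\<dots> \<le> Hd \<Sigma> n p q" using n1 p_less_q by (intro Hd_mono[OF letters]) auto
  also have "\<dots> = H \<Sigma> n p q" using H_otherwise[OF False] by simp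
  finally have "enat h < H \<Sigma> n p q" .
  moreover have "h < hs n" using le_hs[OF range] hK by linarith
  ultimately show ?thesis by blast
qed

text \<open>Outside the standard range, both sides hold from \<open>q + 3 * p\<close> on, since
  \<open>hs\<close> is 5 just before. For \<open>q + 2 * p \<le> n < 3 * q\<close> both fail:
  \<open>hs n\<close> is 4 and the center \<open>q - 1\<close> gives at most 4 holes.\<close>

lemma less_H_iff_less_hs_4:
  assumes pq: "2 * q < 3 * p" and n: "q \<le> n"
  shows "enat 4 < H \<Sigma> n p q \<longleftrightarrow> 4 < hs n"
proof (cases "standard_range n")
  case True
  then show ?thesis using H_standard[OF n] by simp
next
  case False
  have K: "q div p = 1"
    using pq p_less_q by (intro div_nat_eqI) auto
  have n2: "q + 2 * p \<le> n" "n < 3 * q \<or> q + 3 * p \<le> n" using False by (auto simp: K)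
  show ?thesis
  proof (cases "q + 3 * p \<le> n")
    case True
    define n1 where "n1 = q + 3 * p - 1"
    have n1: "2 * q \<le> n1" "standard_range n1" "n1 \<le> n" using True pq p_gt_2 by (auto simp: n1_def)
    have "hs n1 = 5" using hs_at[of 3] by (simp add: n1_def)
    then have "enat 4 < enat (hs n1)" by simp
    also have "\<dots> \<le> Hd \<Sigma> n1 p q" using Hd_ge_hs n1 by blast
    also have "\<dots> \<le> Hd \<Sigma> n p q" using n1 p_less_q by (intro Hd_mono[OF letters]) auto
    also have "\<dots> = H \<Sigma> n p q" using H_otherwise[OF False] by simp
    finally have "enat 4 < H \<Sigma> n p q" .
    moreover have "4 < hs n" using le_hs[OF True] by linarith
    ultimately show ?thesis by blast
  next
    case 2: False
    then have n3: "n < 3 * q" using n2 by simp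
    then have "(n - q) div p = 2" "(n - q + 1) div p = 2"
      using n2(1) pq by (auto intro!: div_nat_eqI)
    then have "hs n = 4" by simp
    moreover have "(n - q) div q = 1"
      using n2(1) n3 pq p_less_q by (intro div_nat_eqI) auto
    then have "sm n (q - 1) \<le> 4"
      using special_last_of_first_row[OF n] K \<open>(n - q) div p = 2\<close> by simp
    then have "Hd \<Sigma> n p q \<le> enat 4" using n p_less_q by (intro Hd_le[of "q - 1"]) auto
    then have "H \<Sigma> n p q \<le> enat 4" using H_otherwise[OF False] by simp
    ultimately show ?thesis by (metis less_irrefl not_less)
  qed
qed

text \<open>In the first range \<open>Hd\<close> is at most \<open>2 * K + 1 \<le> h\<close>, so
  \<open>n\<close> lies in the second. There \<open>Hd\<close> is at most 5, which leaves only
  \<open>h = 3\<close>, and \<open>hs n\<close> is at least 4.\<close>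

lemma less_H_if_less_Hd:
  assumes h: "q \<le> p * ((h + 1) div 2)" "\<not> (h = 4 \<and> 2 * q < 3 * p)"
    and n: "1 \<le> n" "enat h < Hd \<Sigma> n p q"
  shows "enat h < H \<Sigma> n p q"
proof (cases "standard_range n")
  case False
  then show ?thesis using H_otherwise n(2) by simp
next
  case True
  define K where "K = q div p"
  note K = q_bounds[folded K_def]
  have "p * K < p * ((h + 1) div 2)" using h(1) K(1) by (metis mult.commute order.strict_trans2)
  then have "K < (h + 1) div 2" by (simp only: mult_less_cancel1)
  moreover have "2 * ((h + 1) div 2) \<le> h + 1" by auto
  ultimately have hK: "2 * K + 1 \<le> h" by linarith
  have large: "q + (K + 1) * p \<le> n"
  proof (rule ccontr)
    assume small: "\<not> q + (K + 1) * p \<le> n"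
    define n1 where "n1 = q + (K + 1) * p - 1"
    have "n1 - q = (p - 1) + K * p" using p_gt_2 by (simp add: n1_def)
    then have "(n1 - q) div p = K" using p_gt_2 div_mult_self1[of p "p - 1" K] by simp
    moreover have "q \<le> n1 - q" "n1 - q < 2 * q" using K(1,2) p_less_q by (auto simp: n1_def)
    then have "(n1 - q) div q = 1" by (intro div_nat_eqI) auto
    moreover have "q \<le> n1" using K(2) by (simp add: n1_def)
    ultimately have "sm n1 (q - 1) \<le> h"
      using special_last_of_first_row[of n1] hK by (simp add: K_def)
    then have "Hd \<Sigma> n1 p q \<le> enat h" using \<open>q \<le> n1\<close> p_less_q by (intro Hd_le[of "q - 1"]) auto
    moreover have "Hd \<Sigma> n p q \<le> Hd \<Sigma> n1 p q"
      using n(1) small by (intro Hd_mono[OF letters]) (auto simp: n1_def)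
    ultimately show False using n(2) by simp
  qed
  then have n3: "3 * q \<le> n" "n < q + 3 * p" using True by (auto simp: K_def)
  then have pq: "2 * q < 3 * p" by simp
  have "K = 1" unfolding K_def using pq p_less_q by (intro div_nat_eqI) auto
  have "(n - q) div p = 2" "(n - q) div q = 2"
    using n3 p_less_q by (auto intro!: div_nat_eqI)
  then have "sm n (q - 1) \<le> 5"
    using special_last_of_first_row[of n] n3 \<open>K = 1\<close> by (simp add: K_def)
  then have "Hd \<Sigma> n p q \<le> enat 5" using n3 p_less_q by (intro Hd_le[of "q - 1"]) auto
  then have "enat h < enat 5" using n(2) by (meson less_le_trans)
  then have "h = 3" using hK h(2) pq \<open>K = 1\<close> by auto
  moreover have "4 \<le> hs n" using le_hs[of 2 n] n3 p_less_q by simp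
  ultimately show ?thesis using H_standard[OF _ True] n3 by simp
qed

lemma L_formula:
  "L \<Sigma> h p q =
    (if real q / real p > real_of_int \<lceil>real h / 2\<rceil> \<or> (h = 4 \<and> real q / real p < 3 / 2)
     then Ls h p q else Ld \<Sigma> h p q)"
proof -
  have "\<lceil>real h / 2\<rceil> = int ((h + 1) div 2)"
  proof (rule ceiling_unique)
    have "h + 1 \<le> 2 * ((h + 1) div 2) + 1" "2 * ((h + 1) div 2) \<le> h + 1" by auto
    then have "real h \<le> 2 * real ((h + 1) div 2)" "2 * real ((h + 1) div 2) \<le> real h + 1"
      by linarith+
    then show "real_of_int (int ((h + 1) div 2)) - 1 < real h / 2"
      "real h / 2 \<le> real_of_int (int ((h + 1) div 2))" by simp_all
  qed
  then have "real q / real p > real_of_int \<lceil>real h / 2\<rceil> \<longleftrightarrow> real (p * ((h + 1) div 2)) < real q"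
    using p_gt_2 by (simp add: field_simps)
  then have c1: "real q / real p > real_of_int \<lceil>real h / 2\<rceil> \<longleftrightarrow> p * ((h + 1) div 2) < q"
    by (simp only: of_nat_less_iff)
  have c2: "real q / real p < 3 / 2 \<longleftrightarrow> 2 * q < 3 * p"
    using p_gt_2 by (simp add: field_simps) linarith
  consider "p * ((h + 1) div 2) < q" | "h = 4 \<and> 2 * q < 3 * p"
    | "q \<le> p * ((h + 1) div 2)" "\<not> (h = 4 \<and> 2 * q < 3 * p)" by linarith
  then show ?thesis
  proof cases
    case 1
    have "L \<Sigma> h p q = Ls h p q" by (rule L_eq_Ls) (rule less_H_iff_less_hs[OF 1])
    then show ?thesis using 1 by (simp only: c1 simp_thms if_True)
  next
    case 2
    have "L \<Sigma> 4 p q = Ls 4 p q"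
      by (rule L_eq_Ls) (rule less_H_iff_less_hs_4[OF conjunct2[OF 2]])
    then show ?thesis using 2 by (simp only: c2 simp_thms if_True)
  next
    case 3
    then have "\<not> p * ((h + 1) div 2) < q" by linarith
    moreover have "L \<Sigma> h p q = Ld \<Sigma> h p q" by (rule L_eq_Ld) (rule less_H_if_less_Hd[OF 3])
    ultimately show ?thesis using 3(2) by (simp only: c1 c2 simp_thms if_False)
  qed
qed

end

theorem theorem18:
  fixes \<Sigma> :: "'a set" and p q :: nat
  assumes "\<exists>a\<in>\<Sigma>. \<exists>b\<in>\<Sigma>. a \<noteq> b"
    and "coprime p q" and "2 < p" and "p < q"
  shows "(\<forall>n::nat. n \<ge> p + q - 2 \<longrightarrow>
           H \<Sigma> n p q =
             (if int n \<le> int q + int p * \<lceil>real q / real p\<rceil> - 1 \<or>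
                 (3 * int q \<le> int n \<and> int n \<le> int q + 3 * int p - 1)
              then enat (nat (Hs n p q))
              else Hd \<Sigma> n p q)) \<and>
         (\<forall>h::nat.
           L \<Sigma> h p q =
             (if real q / real p > real_of_int \<lceil>real h / 2\<rceil> \<or>
                 (h = 4 \<and> real q / real p < 3 / 2)
              then Ls h p q
              else Ld \<Sigma> h p q))"
proof -
  obtain a b where "a \<in> \<Sigma>" "b \<in> \<Sigma>" "a \<noteq> b" using assms(1) by blast
  then interpret coprime_periods_alphabet p q \<Sigma> a b
    using assms(2-4) by unfold_locales
  show ?thesis using H_formula L_formula by blast
qed

end
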